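(* The broadcast independence number $\alpha_b(T)$ of a given tree $T$ of order $n$ can be determined in $O(n^9)$ time.
   Context: All graphs are finite, simple, and undirected; the order of a graph is its number of vertices. Let $\mathbb{N}_0$ be the set of nonnegative integers. For a connected graph $G$, let ${\rm dist}_G(x,y)$ be the distance of $x$ and $y$ in $G$, and let ${\rm ecc}_G(x)$ be the eccentricity of the vertex $x$ in $G$. A function $f:V(G)\to\mathbb{N}_0$ is an independent broadcast on $G$ if (B1) $f(x)\leq {\rm ecc}_G(x)$ for every vertex $x$ of $G$, and (B2) ${\rm dist}_G(x,y)>\max\{f(x),f(y)\}$ for every two distinct vertices $x$ and $y$ of $G$ with $f(x),f(y)>0$. The weight of $f$ is $\sum_{x\in V(G)}f(x)$, and the broadcast independence number $\alpha_b(G)$ is the maximum weight of an independent broadcast on $G$. *)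

theory Defs
  imports "HOL-Library.Landau_Symbols"
begin

section \<open>Graphs\<close>

text \<open>A graph is given by its vertex set \<open>V\<close> and its set \<open>E\<close> of two-element edges.\<close>

definition simple_graph :: "'a set \<Rightarrow> 'a set set \<Rightarrow> bool" where
  "simple_graph V E \<longleftrightarrow> finite V \<and> V \<noteq> {} \<and> (\<forall>e\<in>E. e \<subseteq> V \<and> card e = 2)"

text \<open>Walks are nonempty vertex lists; the length of a walk is the number of its edges,
  one less than the length of the list.\<close>

definition walk_betw :: "'a set \<Rightarrow> 'a set set \<Rightarrow> 'a \<Rightarrow> 'a list \<Rightarrow> 'a \<Rightarrow> bool" where
  "walk_betw V E x p y \<longleftrightarrow> p \<noteq> [] \<and> set p \<subseteq> V \<and> hd p = x \<and> last p = y \<and>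
     successively (\<lambda>u v. {u, v} \<in> E) p"

definition connected_graph :: "'a set \<Rightarrow> 'a set set \<Rightarrow> bool" where
  "connected_graph V E \<longleftrightarrow> (\<forall>x\<in>V. \<forall>y\<in>V. \<exists>p. walk_betw V E x p y)"

definition is_cycle :: "'a set \<Rightarrow> 'a set set \<Rightarrow> 'a list \<Rightarrow> bool" where
  "is_cycle V E p \<longleftrightarrow> length p \<ge> 3 \<and> distinct p \<and> set p \<subseteq> V \<and>
     successively (\<lambda>u v. {u, v} \<in> E) p \<and> {last p, hd p} \<in> E"

definition is_tree :: "'a set \<Rightarrow> 'a set set \<Rightarrow> bool" where
  "is_tree V E \<longleftrightarrow> simple_graph V E \<and> connected_graph V E \<and> (\<nexists>p. is_cycle V E p)"

definition gdist :: "'a set \<Rightarrow> 'a set set \<Rightarrow> 'a \<Rightarrow> 'a \<Rightarrow> nat" where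
  "gdist V E x y = (LEAST k. \<exists>p. walk_betw V E x p y \<and> length p = Suc k)"

definition ecc :: "'a set \<Rightarrow> 'a set set \<Rightarrow> 'a \<Rightarrow> nat" where
  "ecc V E x = Max (gdist V E x ` V)"

section \<open>Independent broadcasts\<close>

text \<open>Only the values on \<open>V\<close> of a function \<open>f\<close> matter.\<close>

definition independent_broadcast :: "'a set \<Rightarrow> 'a set set \<Rightarrow> ('a \<Rightarrow> nat) \<Rightarrow> bool" where
  "independent_broadcast V E f \<longleftrightarrow>
     (\<forall>x\<in>V. f x \<le> ecc V E x) \<and>
     (\<forall>x\<in>V. \<forall>y\<in>V. x \<noteq> y \<and> f x > 0 \<and> f y > 0 \<longrightarrow> gdist V E x y > max (f x) (f y))"

definition broadcast_independence_number :: "'a set \<Rightarrow> 'a set set \<Rightarrow> nat" where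
  "broadcast_independence_number V E =
     Max {(\<Sum>x\<in>V. f x) | f. independent_broadcast V E f}"

lemma finite_broadcast_weights:
  "finite {(\<Sum>x\<in>V. f x) | f. independent_broadcast V E f}"
proof (rule finite_subset)
  show "{(\<Sum>x\<in>V. f x) | f. independent_broadcast V E f} \<subseteq> {..\<Sum>x\<in>V. ecc V E x}"
    by (auto simp: independent_broadcast_def intro!: sum_mono)
qed simp

lemma independent_broadcast_zero: "independent_broadcast V E (\<lambda>_. 0)"
  by (simp add: independent_broadcast_def)

section \<open>Random access machines\<close>

text \<open>A machine has registers and a memory, both indexed by natural numbers and holding
  natural numbers; a program can only mention finitely many registers, and it reaches the
  memory by indirect addressing. Subtraction is truncated.\<close>

datatype ram_prog =
    SKIP
  | IMM nat nat                         (* R[i] := k *)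
  | ADD nat nat nat                    (* R[i] := R[j] + R[k] *)
  | SUB nat nat nat                    (* R[i] := R[j] - R[k] *)
  | MUL nat nat nat                    (* R[i] := R[j] * R[k] *)
  | LOAD nat nat                       (* R[i] := M[R[j]] *)
  | STORE nat nat                      (* M[R[i]] := R[j] *)
  | SEQ ram_prog ram_prog
  | IFNZ nat ram_prog ram_prog         (* branch on R[i] > 0 *)
  | WHILENZ nat ram_prog               (* loop while R[i] > 0 *)

type_synonym ram_state = "(nat \<Rightarrow> nat) \<times> (nat \<Rightarrow> nat)"

text \<open>\<open>ram_exec L P s t s'\<close>: started in state \<open>s\<close>, program \<open>P\<close> halts in state \<open>s'\<close> after
  exactly \<open>t\<close> steps, where every operation and every test is one step. The parameter \<open>L\<close> is the
  word limit: a step that would write a value not below \<open>L\<close> has no successor, so a halting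
  execution only ever handles machine words. This is what justifies counting
  each arithmetic operation as a single step.\<close>

inductive ram_exec :: "nat \<Rightarrow> ram_prog \<Rightarrow> ram_state \<Rightarrow> nat \<Rightarrow> ram_state \<Rightarrow> bool" for L where
  Skip: "ram_exec L SKIP s 1 s"
| Imm: "k < L \<Longrightarrow> ram_exec L (IMM i k) (R, M) 1 (R(i := k), M)"
| Add: "R j + R k < L \<Longrightarrow> ram_exec L (ADD i j k) (R, M) 1 (R(i := R j + R k), M)"
| Sub: "R j - R k < L \<Longrightarrow> ram_exec L (SUB i j k) (R, M) 1 (R(i := R j - R k), M)"
| Mul: "R j * R k < L \<Longrightarrow> ram_exec L (MUL i j k) (R, M) 1 (R(i := R j * R k), M)"
| Load: "M (R j) < L \<Longrightarrow> ram_exec L (LOAD i j) (R, M) 1 (R(i := M (R j)), M)"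
| Store: "R j < L \<Longrightarrow> ram_exec L (STORE i j) (R, M) 1 (R, M(R i := R j))"
| Seq: "ram_exec L P s t s' \<Longrightarrow> ram_exec L Q s' t' s'' \<Longrightarrow> ram_exec L (SEQ P Q) s (t + t') s''"
| IfTrue: "R i > 0 \<Longrightarrow> ram_exec L P (R, M) t s' \<Longrightarrow> ram_exec L (IFNZ i P Q) (R, M) (Suc t) s'"
| IfFalse: "R i = 0 \<Longrightarrow> ram_exec L Q (R, M) t s' \<Longrightarrow> ram_exec L (IFNZ i P Q) (R, M) (Suc t) s'"
| WhileFalse: "R i = 0 \<Longrightarrow> ram_exec L (WHILENZ i P) (R, M) 1 (R, M)"
| WhileTrue: "R i > 0 \<Longrightarrow> ram_exec L P (R, M) t s' \<Longrightarrow> ram_exec L (WHILENZ i P) s' t' s'' \<Longrightarrow>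
    ram_exec L (WHILENZ i P) (R, M) (Suc (t + t')) s''"

inductive_cases ram_exec_SkipE: "ram_exec L SKIP s t s'"
inductive_cases ram_exec_ImmE: "ram_exec L (IMM i k) s t s'"
inductive_cases ram_exec_AddE: "ram_exec L (ADD i j k) s t s'"
inductive_cases ram_exec_SubE: "ram_exec L (SUB i j k) s t s'"
inductive_cases ram_exec_MulE: "ram_exec L (MUL i j k) s t s'"
inductive_cases ram_exec_LoadE: "ram_exec L (LOAD i j) s t s'"
inductive_cases ram_exec_StoreE: "ram_exec L (STORE i j) s t s'"
inductive_cases ram_exec_SeqE: "ram_exec L (SEQ P Q) s t s'"
inductive_cases ram_exec_IfE: "ram_exec L (IFNZ i P Q) s t s'"
inductive_cases ram_exec_WhileE: "ram_exec L (WHILENZ i P) s t s'"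

lemma ram_exec_deterministic:
  "ram_exec L P s t s' \<Longrightarrow> ram_exec L P s u v \<Longrightarrow> t = u \<and> s' = v"
proof (induction arbitrary: u v rule: ram_exec.induct)
  case Skip then show ?case by (auto elim: ram_exec_SkipE)
next
  case Imm then show ?case by (auto elim: ram_exec_ImmE)
next
  case Add then show ?case by (auto elim: ram_exec_AddE)
next
  case Sub then show ?case by (auto elim: ram_exec_SubE)
next
  case Mul then show ?case by (auto elim: ram_exec_MulE)
next
  case Load then show ?case by (auto elim: ram_exec_LoadE)
next
  case Store then show ?case by (auto elim: ram_exec_StoreE)
next
  case (Seq P s t s' Q t' s'')
  from Seq.prems obtain t1 s1 t2
    where *: "u = t1 + t2" "ram_exec L P s t1 s1" "ram_exec L Q s1 t2 v"
    by (rule ram_exec_SeqE)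
  have "t = t1" and "s' = s1" using Seq.IH(1)[OF *(2)] by simp_all
  moreover from this *(3) have "t' = t2 \<and> s'' = v" by (intro Seq.IH(2)) simp
  ultimately show ?case using *(1) by simp
next
  case (IfTrue R i P M t s' Q)
  from IfTrue.prems IfTrue.hyps obtain t1 where *: "u = Suc t1" "ram_exec L P (R, M) t1 v"
    by (auto elim: ram_exec_IfE)
  then show ?case using IfTrue.IH[OF *(2)] by simp
next
  case (IfFalse R i Q M t s' P)
  from IfFalse.prems IfFalse.hyps obtain t1 where *: "u = Suc t1" "ram_exec L Q (R, M) t1 v"
    by (auto elim: ram_exec_IfE)
  then show ?case using IfFalse.IH[OF *(2)] by simp
next
  case (WhileFalse R i P M)
  from WhileFalse.prems show ?case by (rule ram_exec_WhileE) (use WhileFalse.hyps in auto)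
next
  case (WhileTrue R i P M t s' t' s'')
  from WhileTrue.prems WhileTrue.hyps obtain t1 s1 t2
    where *: "u = Suc (t1 + t2)" "ram_exec L P (R, M) t1 s1" "ram_exec L (WHILENZ i P) s1 t2 v"
    by (auto elim: ram_exec_WhileE)
  have "t = t1" and "s' = s1" using WhileTrue.IH(1)[OF *(2)] by simp_all
  moreover from this *(3) have "t' = t2 \<and> s'' = v" by (intro WhileTrue.IH(2)) simp
  ultimately show ?case using *(1) by simp
qed

text \<open>The input word list occupies the first memory cells; everything else is zero. The output
  is read off register 0.\<close>

definition ram_computes :: "nat \<Rightarrow> ram_prog \<Rightarrow> nat list \<Rightarrow> nat \<Rightarrow> nat \<Rightarrow> bool" where
  "ram_computes L P xs t out \<longleftrightarrow>
     (\<exists>R M. ram_exec L P (\<lambda>_. 0, \<lambda>a. if a < length xs then xs ! a else 0) t (R, M) \<and> R 0 = out)"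

section \<open>Encoding graphs\<close>

text \<open>An edge list names every edge exactly once, in arbitrary order and orientation.\<close>

definition edge_list_of :: "'a set set \<Rightarrow> ('a \<times> 'a) list \<Rightarrow> bool" where
  "edge_list_of E es \<longleftrightarrow> (\<lambda>(u, v). {u, v}) ` set es = E \<and> length es = card E"

text \<open>A graph with vertex set \<open>{0..<n}\<close> is input as the number of vertices, the number of edges,
  and the two ends of each edge.\<close>

definition graph_input :: "nat \<Rightarrow> (nat \<times> nat) list \<Rightarrow> nat list" where
  "graph_input n es = n # length es # concat (map (\<lambda>(u, v). [u, v]) es)"

end

theory Submission
  imports Defs
begin

text \<open>A dynamic program over the tree solves the problem with \<open>O(n\<^sup>5)\<close> machine steps.

  Cut the tree at an edge. For a vertex \<open>x\<close> on one side and a vertex \<open>y\<close> on the other, the distance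
  is the sum of their depths, measured from the ends \<open>r\<close> and \<open>c\<close> of the edge, plus one. Hence the
  conditions \<open>dist x y > f x\<close> and \<open>dist x y > f y\<close> for all such pairs depend on the restriction of a
  broadcast to one side through two numbers only: the least depth of a vertex with positive value,
  and the largest \<open>f x\<close> minus the depth of \<open>x\<close>, that is, how far the balls reach across the edge. For
  each part of the tree that hangs at a vertex, the algorithm tabulates the maximum weight of a
  broadcast on this part for all \<open>O(n\<^sup>2)\<close> bounds \<open>q\<close> and \<open>p\<close> on these two numbers. The
  tables of two parts joined by an edge are combined by the recurrence \<open>merge\<close>, which is justified by
  \<open>opt_merge\<close> and takes \<open>O(n\<^sup>2)\<close> steps for each of the \<open>O(n\<^sup>2)\<close> entries. Contracting the
  \<open>n - 1\<close> edges one after the other, always at a leaf of the remaining tree, gives the bound.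

  The order of the contractions is the reverse of the order in which a search from vertex \<open>0\<close> finds the
  vertices. Because the graph is acyclic, the edges used by the search are all its edges
  (\<open>tree_edges_eq_growth\<close>), and a recursion along the search computes all distances
  (\<open>gdist_eq_tdist\<close>). The distances are needed for the eccentricities, which bound the values of a
  broadcast; in all other respects the tables only use that the distance grows by one with
  each contracted edge (\<open>clusters_leaf\<close>).

  The machine program is compiled from a small language of bounded loops. Its compiler is
  verified once (\<open>comp_exp_correct\<close> and \<open>comp_cmd_correct\<close>), including the word limit and a running
  time that is polynomial in \<open>n\<close> with the nesting depth of the loops as its degree
  (\<open>cmd_time_poly\<close>). The algorithm itself is then verified by loop invariants on the memory
  (\<open>wp_main\<close>).\<close>

section \<open>A language of bounded loops\<close>

text \<open>A recursion instead of the maximum of an image: each equation is one pass of the loop that computes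
it, and the empty range has the harmless value \<open>0\<close>.\<close>

primrec mx :: "(nat \<Rightarrow> nat) \<Rightarrow> nat \<Rightarrow> nat" where
  "mx g 0 = 0"
| "mx g (Suc i) = max (mx g i) (g i)"

primrec iter :: "(nat \<Rightarrow> 's \<Rightarrow> 's) \<Rightarrow> nat \<Rightarrow> 's \<Rightarrow> 's" where
  "iter f 0 s = s"
| "iter f (Suc i) s = f i (iter f i s)"

text \<open>Programs are written in a small language whose only state is the memory. Variables are scoped: they
are introduced by a binder or by a loop, hold their value throughout their scope, and are then
forgotten. Loops run over a range given by a variable, so evaluation is a total function, a program
has no other side effects than its writes, and a bound on the values of the variables bounds every
number of iterations. The bounded maximum is an expression, which turns the innermost loops of the
algorithm into terms.\<close>

datatype 'v exp =
    Var 'v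
  | Const nat
  | Plus "'v exp" "'v exp"
  | Minus "'v exp" "'v exp"
  | Times "'v exp" "'v exp"
  | Read "'v exp"
  | MaxOver 'v 'v "'v exp"

primrec ev :: "'v exp \<Rightarrow> ('v \<Rightarrow> nat) \<Rightarrow> (nat \<Rightarrow> nat) \<Rightarrow> nat" where
  "ev (Var v) \<sigma> M = \<sigma> v"
| "ev (Const c) \<sigma> M = c"
| "ev (Plus a b) \<sigma> M = ev a \<sigma> M + ev b \<sigma> M"
| "ev (Minus a b) \<sigma> M = ev a \<sigma> M - ev b \<sigma> M"
| "ev (Times a b) \<sigma> M = ev a \<sigma> M * ev b \<sigma> M"
| "ev (Read a) \<sigma> M = M (ev a \<sigma> M)"
| "ev (MaxOver x y e) \<sigma> M = mx (\<lambda>i. ev e (\<sigma>(x := i)) M) (\<sigma> y)"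

text \<open>\<open>\<rho>\<close> maps variables to registers below \<open>k\<close>; the value is left in register \<open>k\<close>, and the registers below
\<open>k\<close> are preserved, so that enclosing computations survive. For a maximum, register \<open>k\<close> counts down the
iterations, \<open>k + 1\<close> is the bound variable and \<open>k + 2\<close> the maximum so far, updated by
\<open>max a v = a + (v - a)\<close> with truncated subtraction.\<close>

primrec comp_exp :: "'v exp \<Rightarrow> ('v \<Rightarrow> nat) \<Rightarrow> nat \<Rightarrow> ram_prog" where
  "comp_exp (Var v) \<rho> k = SEQ (IMM k 0) (ADD k k (\<rho> v))"
| "comp_exp (Const c) \<rho> k = IMM k c"
| "comp_exp (Plus a b) \<rho> k = SEQ (comp_exp a \<rho> k) (SEQ (comp_exp b \<rho> (k + 1)) (ADD k k (k + 1)))"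
| "comp_exp (Minus a b) \<rho> k = SEQ (comp_exp a \<rho> k) (SEQ (comp_exp b \<rho> (k + 1)) (SUB k k (k + 1)))"
| "comp_exp (Times a b) \<rho> k = SEQ (comp_exp a \<rho> k) (SEQ (comp_exp b \<rho> (k + 1)) (MUL k k (k + 1)))"
| "comp_exp (Read a) \<rho> k = SEQ (comp_exp a \<rho> k) (LOAD k k)"
| "comp_exp (MaxOver x y e) \<rho> k =
     SEQ (IMM k 0) (SEQ (ADD k k (\<rho> y)) (SEQ (IMM (k + 1) 0) (SEQ (IMM (k + 2) 0)
       (SEQ (WHILENZ k
              (SEQ (comp_exp e (\<rho>(x := k + 1)) (k + 3))
              (SEQ (SUB (k + 3) (k + 3) (k + 2)) (SEQ (ADD (k + 2) (k + 2) (k + 3))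
              (SEQ (IMM (k + 3) 1) (SEQ (ADD (k + 1) (k + 1) (k + 3)) (SUB k k (k + 3))))))))
       (ADD k k (k + 2))))))"

text \<open>Here \<open>b\<close> bounds the values of all variables, hence the length of every range.\<close>

primrec exp_time :: "nat \<Rightarrow> 'v exp \<Rightarrow> nat" where
  "exp_time b (Var v) = 2"
| "exp_time b (Const c) = 1"
| "exp_time b (Plus e f) = exp_time b e + exp_time b f + 1"
| "exp_time b (Minus e f) = exp_time b e + exp_time b f + 1"
| "exp_time b (Times e f) = exp_time b e + exp_time b f + 1"
| "exp_time b (Read e) = exp_time b e + 1"
| "exp_time b (MaxOver x y e) = 6 + b * (exp_time b e + 6)"

text \<open>An exponent: if all variables and memory cells are at most \<open>X \<ge> 2\<close>, then every value met while the
expression is evaluated is at most \<open>X\<close> to this power. A constant \<open>c\<close> counts as \<open>Suc c\<close> because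
\<open>c \<le> X ^ c\<close>.\<close>

primrec exp_size :: "'v exp \<Rightarrow> nat" where
  "exp_size (Var v) = 1"
| "exp_size (Const c) = Suc c"
| "exp_size (Plus a b) = exp_size a + exp_size b"
| "exp_size (Minus a b) = exp_size a + exp_size b"
| "exp_size (Times a b) = exp_size a + exp_size b"
| "exp_size (Read a) = exp_size a"
| "exp_size (MaxOver x y e) = exp_size e"

lemma exp_size_pos: "exp_size e > 0"
  by (induction e) auto

lemma mx_least: "(\<And>i. i < n \<Longrightarrow> g i \<le> c) \<Longrightarrow> mx g n \<le> c"
  by (induction n) auto

lemma mx_upper: "i < n \<Longrightarrow> g i \<le> mx g n"
  by (induction n) (auto simp: less_Suc_eq le_max_iff_disj)

lemma mx_cong: "(\<And>i. i < n \<Longrightarrow> f i = g i) \<Longrightarrow> mx f n = mx g n"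
  by (induction n) auto

section \<open>Execution within a time bound\<close>

definition reach :: "nat \<Rightarrow> ram_prog \<Rightarrow> ram_state \<Rightarrow> nat \<Rightarrow> ((nat \<Rightarrow> nat) \<Rightarrow> (nat \<Rightarrow> nat) \<Rightarrow> bool) \<Rightarrow> bool"
  where "reach L P s T Q \<longleftrightarrow> (\<exists>t\<le>T. \<exists>R M. ram_exec L P s t (R, M) \<and> Q R M)"

lemma reach_mono:
  "reach L P s T Q \<Longrightarrow> T \<le> T' \<Longrightarrow> (\<And>R M. Q R M \<Longrightarrow> Q' R M) \<Longrightarrow> reach L P s T' Q'"
  unfolding reach_def by (meson le_trans)

lemma reach_seq:
  "reach L P s T (\<lambda>R M. reach L P' (R, M) T' Q) \<Longrightarrow> reach L (SEQ P P') s (T + T') Q"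
  unfolding reach_def by (meson add_mono ram_exec.Seq)

lemma reach_seq1:
  "reach L P s 1 (\<lambda>R M. reach L P' (R, M) T Q) \<Longrightarrow> reach L (SEQ P P') s (Suc T) Q"
  using reach_seq[of L P s 1 P' T Q] by simp

lemma reach_imm: "k < L \<Longrightarrow> Q (R(i := k)) M \<Longrightarrow> reach L (IMM i k) (R, M) 1 Q"
  unfolding reach_def by (blast intro: ram_exec.Imm)
lemma reach_add: "R j + R k < L \<Longrightarrow> Q (R(i := R j + R k)) M \<Longrightarrow> reach L (ADD i j k) (R, M) 1 Q"
  unfolding reach_def by (blast intro: ram_exec.Add)
lemma reach_sub: "R j - R k < L \<Longrightarrow> Q (R(i := R j - R k)) M \<Longrightarrow> reach L (SUB i j k) (R, M) 1 Q"
  unfolding reach_def by (blast intro: ram_exec.Sub)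
lemma reach_mul: "R j * R k < L \<Longrightarrow> Q (R(i := R j * R k)) M \<Longrightarrow> reach L (MUL i j k) (R, M) 1 Q"
  unfolding reach_def by (blast intro: ram_exec.Mul)
lemma reach_load: "M (R j) < L \<Longrightarrow> Q (R(i := M (R j))) M \<Longrightarrow> reach L (LOAD i j) (R, M) 1 Q"
  unfolding reach_def by (blast intro: ram_exec.Load)
lemma reach_store: "R j < L \<Longrightarrow> Q R (M(R i := R j)) \<Longrightarrow> reach L (STORE i j) (R, M) 1 Q"
  unfolding reach_def by (blast intro: ram_exec.Store)
lemma reach_skip: "Q R M \<Longrightarrow> reach L SKIP (R, M) 1 Q"
  unfolding reach_def by (blast intro: ram_exec.Skip)
lemma reach_if:
  assumes "reach L (if R i > 0 then P else P') (R, M) T Q"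
  shows "reach L (IFNZ i P P') (R, M) (Suc T) Q"
proof -
  obtain t R' M' where t: "t \<le> T" "ram_exec L (if R i > 0 then P else P') (R, M) t (R', M')" "Q R' M'"
    using assms unfolding reach_def by blast
  then have "ram_exec L (IFNZ i P P') (R, M) (Suc t) (R', M')"
    by (cases "R i > 0") (auto intro: ram_exec.IfTrue ram_exec.IfFalse)
  then show ?thesis unfolding reach_def using t by (meson Suc_le_mono)
qed

text \<open>The invariant is indexed by the number of iterations that remain, which is what the guard register
holds.\<close>

lemma reach_countdown:
  assumes "I n R M" and "R k = n"
    and step: "\<And>j R M. I (Suc j) R M \<Longrightarrow> R k = Suc j \<Longrightarrow>
      reach L P (R, M) T (\<lambda>R' M'. I j R' M' \<and> R' k = j)"
  shows "reach L (WHILENZ k P) (R, M) (1 + n * (T + 1)) (\<lambda>R' M'. I 0 R' M' \<and> R' k = 0)"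
  using assms(1,2)
proof (induction n arbitrary: R M)
  case 0
  then have "ram_exec L (WHILENZ k P) (R, M) 1 (R, M)" by (intro ram_exec.WhileFalse) simp
  moreover have "1 \<le> 1 + 0 * (T + 1)" by simp
  ultimately show ?case unfolding reach_def using 0 by blast
next
  case (Suc n)
  from step[OF Suc.prems] obtain t R1 M1
    where 1: "t \<le> T" "ram_exec L P (R, M) t (R1, M1)" "I n R1 M1" "R1 k = n"
    unfolding reach_def by blast
  from Suc.IH[OF 1(3,4)] obtain t' R2 M2
    where 2: "t' \<le> 1 + n * (T + 1)" "ram_exec L (WHILENZ k P) (R1, M1) t' (R2, M2)"
      "I 0 R2 M2" "R2 k = 0"
    unfolding reach_def by blast
  have "ram_exec L (WHILENZ k P) (R, M) (Suc (t + t')) (R2, M2)"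
    using Suc.prems 1(2) 2(2) by (auto intro: ram_exec.WhileTrue)
  moreover have "Suc (t + t') \<le> 1 + Suc n * (T + 1)" using 1(1) 2(1) by simp
  ultimately show ?case unfolding reach_def using 2(3,4) by blast
qed

lemma add_le_mult_nat: "2 \<le> a \<Longrightarrow> 2 \<le> b \<Longrightarrow> a + b \<le> a * (b::nat)"
proof -
  assume "2 \<le> a" "2 \<le> b"
  then obtain i j where "a = 2 + i" "b = 2 + j" by (metis le_Suc_ex)
  then show ?thesis by simp
qed

lemma pow_exp_size_ge: "2 \<le> X \<Longrightarrow> 2 \<le> X ^ exp_size (e :: 'v exp)" for X :: nat
  using exp_size_pos[of e] by (metis One_nat_def Suc_leI le_trans power_increasing power_one_right one_le_numeral)

lemma ev_le:
  assumes "2 \<le> X" "\<And>v. \<sigma> v \<le> X" "\<And>a. M a \<le> X"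
  shows "ev e \<sigma> M \<le> X ^ exp_size e"
  using assms(2)
proof (induction e arbitrary: \<sigma>)
  case (Const c)
  have "c < 2 ^ c" by simp
  also have "\<dots> \<le> X ^ c" using assms(1) by (intro power_mono) auto
  also have "\<dots> \<le> X ^ Suc c" using assms(1) by (intro power_increasing) auto
  finally show ?case by simp
next
  case (Plus a b)
  have "ev a \<sigma> M + ev b \<sigma> M \<le> X ^ exp_size a + X ^ exp_size b"
    using Plus by (intro add_mono) auto
  also have "\<dots> \<le> X ^ exp_size a * X ^ exp_size b"
    by (intro add_le_mult_nat pow_exp_size_ge assms(1))
  finally show ?case by (simp add: power_add)
next
  case (Minus a b)
  have "ev a \<sigma> M - ev b \<sigma> M \<le> X ^ exp_size a" using Minus.IH(1)[of \<sigma>] Minus.prems by simp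
  also have "\<dots> \<le> X ^ (exp_size a + exp_size b)" using assms(1) by (intro power_increasing) auto
  finally show ?case by simp
next
  case (Times a b)
  then show ?case by (simp add: power_add mult_mono)
next
  case (Read a)
  have "M (ev a \<sigma> M) \<le> X" by (rule assms(3))
  also have "X \<le> X ^ exp_size a" using exp_size_pos[of a] assms(1) by (simp add: self_le_power)
  finally show ?case by simp
next
  case (MaxOver x y e)
  have "ev e (\<sigma>(x := i)) M \<le> X ^ exp_size e" if "i < \<sigma> y" for i
    using that MaxOver.prems by (intro MaxOver.IH) (auto intro: le_trans[OF less_imp_le])
  then show ?case by (auto intro: mx_least)
qed (use assms in auto)

lemma reach_binary:
  assumes P: "reach L P (R, M) T (\<lambda>R' M'. M' = M \<and> R' k = x \<and> (\<forall>i<k. R' i = R i))"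
    and P': "\<And>R1. R1 k = x \<Longrightarrow> (\<And>i. i < k \<Longrightarrow> R1 i = R i) \<Longrightarrow>
      reach L P' (R1, M) T' (\<lambda>R' M'. M' = M \<and> R' (k + 1) = y \<and> (\<forall>i<k + 1. R' i = R1 i))"
    and Op: "\<And>R2 Q. R2 k = x \<Longrightarrow> R2 (k + 1) = y \<Longrightarrow> Q (R2(k := z)) M \<Longrightarrow> reach L Op (R2, M) 1 Q"
  shows "reach L (SEQ P (SEQ P' Op)) (R, M) (T + T' + 1)
    (\<lambda>R' M'. M' = M \<and> R' k = z \<and> (\<forall>i<k. R' i = R i))"
  unfolding add.assoc
  by (rule reach_seq, rule reach_mono[OF P order_refl], clarify, rule reach_seq,
      rule reach_mono[OF P' order_refl]) (auto intro!: Op[simplified])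

text \<open>No overflow can happen inside an expression, because every intermediate value is the value of a
subexpression, a partial maximum or a loop counter, and thus bounded by the power given by the
size.\<close>

lemma comp_exp_correct:
  assumes X: "2 \<le> X" "b \<le> X" "\<And>a. M a \<le> X"
  shows "X ^ exp_size e < L \<Longrightarrow> (\<And>v. \<rho> v < k) \<Longrightarrow> (\<And>v. R (\<rho> v) = \<sigma> v) \<Longrightarrow> (\<And>v. \<sigma> v \<le> b) \<Longrightarrow>
    reach L (comp_exp e \<rho> k) (R, M) (exp_time b e)
      (\<lambda>R' M'. M' = M \<and> R' k = ev e \<sigma> M \<and> (\<forall>i<k. R' i = R i))"
proof (induction e arbitrary: \<rho> k R \<sigma>)
  case (Var v)
  have *: "\<sigma> v < L" "0 < L" using Var.prems(1) Var.prems(4)[of v] assms(2) by simp_all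
  have "reach L (SEQ (IMM k 0) (ADD k k (\<rho> v))) (R, M) (Suc 1)
    (\<lambda>R' M'. M' = M \<and> R' k = ev (Var v) \<sigma> M \<and> (\<forall>i<k. R' i = R i))"
    using Var.prems(2)[of v] Var.prems(3)[of v] *
    by (intro reach_seq1 reach_imm reach_add) auto
  then show ?case by (simp add: numeral_2_eq_2)
next
  case (Const c)
  have "c \<le> X ^ exp_size (Const c :: 'a exp)"
    using ev_le[of X "\<lambda>_. 0" "\<lambda>_. 0" "Const c"] assms by simp
  then have "c < L" using Const.prems(1) by simp
  then show ?case by (auto intro!: reach_imm[simplified])
next
  case (Plus e f)
  note sz = le_less_trans[OF power_increasing Plus.prems(1)]
  have L: "ev (Plus e f) \<sigma> M < L"
    by (rule le_less_trans[OF ev_le Plus.prems(1)]) (use Plus.prems(4) X in \<open>auto intro: le_trans\<close>)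
  show ?case unfolding comp_exp.simps exp_time.simps
  proof (rule reach_binary[OF Plus.IH(1) Plus.IH(2)])
    fix R2 Q assume "R2 k = ev e \<sigma> M" "R2 (k + 1) = ev f \<sigma> M" "Q (R2(k := ev (Plus e f) \<sigma> M)) M"
    then show "reach L (ADD k k (k + 1)) (R2, M) 1 Q" using L by (intro reach_add) auto
  qed (use Plus.prems X in \<open>auto intro: sz less_SucI\<close>)
next
  case (Minus e f)
  note sz = le_less_trans[OF power_increasing Minus.prems(1)]
  have L: "ev (Minus e f) \<sigma> M < L"
    by (rule le_less_trans[OF ev_le Minus.prems(1)]) (use Minus.prems(4) X in \<open>auto intro: le_trans\<close>)
  show ?case unfolding comp_exp.simps exp_time.simps
  proof (rule reach_binary[OF Minus.IH(1) Minus.IH(2)])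
    fix R2 Q assume "R2 k = ev e \<sigma> M" "R2 (k + 1) = ev f \<sigma> M" "Q (R2(k := ev (Minus e f) \<sigma> M)) M"
    then show "reach L (SUB k k (k + 1)) (R2, M) 1 Q" using L by (intro reach_sub) auto
  qed (use Minus.prems X in \<open>auto intro: sz less_SucI\<close>)
next
  case (Times e f)
  note sz = le_less_trans[OF power_increasing Times.prems(1)]
  have L: "ev (Times e f) \<sigma> M < L"
    by (rule le_less_trans[OF ev_le Times.prems(1)]) (use Times.prems(4) X in \<open>auto intro: le_trans\<close>)
  show ?case unfolding comp_exp.simps exp_time.simps
  proof (rule reach_binary[OF Times.IH(1) Times.IH(2)])
    fix R2 Q assume "R2 k = ev e \<sigma> M" "R2 (k + 1) = ev f \<sigma> M" "Q (R2(k := ev (Times e f) \<sigma> M)) M"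
    then show "reach L (MUL k k (k + 1)) (R2, M) 1 Q" using L by (intro reach_mul) auto
  qed (use Times.prems X in \<open>auto intro: sz less_SucI\<close>)
next
  case (Read e)
  have L: "ev (Read e) \<sigma> M < L"
    by (rule le_less_trans[OF ev_le Read.prems(1)]) (use Read.prems(4) X in \<open>auto intro: le_trans\<close>)
  show ?case unfolding comp_exp.simps exp_time.simps
    by (rule reach_seq, rule reach_mono[OF Read.IH order_refl])
      (use Read.prems L in \<open>auto intro!: reach_load[simplified]\<close>)
next
  case (MaxOver x y e)
  let ?n = "\<sigma> y" and ?g = "\<lambda>i. ev e (\<sigma>(x := i)) M"
  have X1: "X ^ 1 \<le> X ^ exp_size e"
    using X(1) exp_size_pos[of e] by (intro power_increasing) auto
  then have XL: "X < L" using MaxOver.prems(1) by simp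
  have n: "?n \<le> b" by (rule MaxOver.prems(4))
  have gL: "?g i \<le> X ^ exp_size e" if "i < ?n" for i
  proof (rule ev_le)
    show "(\<sigma>(x := i)) v \<le> X" for v using that n X(2) MaxOver.prems(4)[of v] by auto
  qed (use X in auto)
  have mL: "mx ?g i < L" if "i \<le> ?n" for i
  proof -
    have "mx ?g i \<le> X ^ exp_size e" using that by (intro mx_least gL) auto
    then show ?thesis using MaxOver.prems(1) by simp
  qed
  \<comment> \<open>With \<open>j\<close> iterations left, the first \<open>?n - j\<close> values have been taken into account.\<close>
  define I where "I j R' M' \<longleftrightarrow> M' = M \<and> (\<forall>i<k. R' i = R i) \<and> j \<le> ?n \<and> R' (k + 1) = ?n - j \<and>
    R' (k + 2) = mx ?g (?n - j)" for j R' M'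
  let ?body = "SEQ (comp_exp e (\<rho>(x := k + 1)) (k + 3))
              (SEQ (SUB (k + 3) (k + 3) (k + 2)) (SEQ (ADD (k + 2) (k + 2) (k + 3))
              (SEQ (IMM (k + 3) 1) (SEQ (ADD (k + 1) (k + 1) (k + 3)) (SUB k k (k + 3))))))"
  have body: "reach L ?body (R', M') (exp_time b e + 5) (\<lambda>R' M'. I j R' M' \<and> R' k = j)"
    if I: "I (Suc j) R' M'" and j: "R' k = Suc j" for j R' M'
  proof -
    let ?i = "?n - Suc j"
    have jn: "Suc j \<le> ?n" "?n - j = Suc ?i" "?i < ?n" using I unfolding I_def by auto
    have e: "reach L (comp_exp e (\<rho>(x := k + 1)) (k + 3)) (R', M) (exp_time b e)
      (\<lambda>R'' M''. M'' = M \<and> R'' (k + 3) = ev e (\<sigma>(x := ?i)) M \<and> (\<forall>i<k + 3. R'' i = R' i))"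
    proof (rule MaxOver.IH)
      show "X ^ exp_size e < L" using MaxOver.prems(1) by simp
      show "(\<rho>(x := k + 1)) v < k + 3" for v using MaxOver.prems(2)[of v] by auto
      show "R' ((\<rho>(x := k + 1)) v) = (\<sigma>(x := ?i)) v" for v
        using MaxOver.prems(2,3)[of v] I unfolding I_def by auto
      show "(\<sigma>(x := ?i)) v \<le> b" for v using MaxOver.prems(4)[of v] n by auto
    qed
    have five: "exp_time b e + 5 = exp_time b e + Suc (Suc (Suc (Suc 1)))" by simp
    have M': "M' = M" using I unfolding I_def by simp
    show ?thesis unfolding five M'
      apply (rule reach_seq, rule reach_mono[OF e order_refl], clarify)
      apply (rule reach_seq1, rule reach_sub)
      subgoal using gL[OF jn(3)] MaxOver.prems(1) by simp
      apply (rule reach_seq1, rule reach_add)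
      subgoal using mL[of "Suc ?i"] I jn unfolding I_def by (simp add: max_def split: if_splits)
      apply (rule reach_seq1, rule reach_imm)
      subgoal using XL X by simp
      apply (rule reach_seq1, rule reach_add)
      subgoal using I jn n X(2) XL unfolding I_def by simp
      apply (rule reach_sub)
      subgoal using I jn n X(2) XL j unfolding I_def by simp
      subgoal using I jn j unfolding I_def by (simp add: max_def)
      done
  qed
  have T: "exp_time b (MaxOver x y e) = Suc (Suc (Suc (Suc (1 + b * (exp_time b e + 5 + 1) + 1))))"
    by simp
  have le: "1 + ?n * (exp_time b e + 5 + 1) \<le> 1 + b * (exp_time b e + 5 + 1)" using n by simp
  show ?case unfolding comp_exp.simps T
    apply (rule reach_seq1, rule reach_imm)
    subgoal using XL by simp
    apply (rule reach_seq1, rule reach_add)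
    subgoal using XL X n MaxOver.prems(2,3)[of y] by simp
    apply (rule reach_seq1, rule reach_imm)
    subgoal using XL by simp
    apply (rule reach_seq1, rule reach_imm)
    subgoal using XL by simp
    apply (rule reach_seq, rule reach_mono[OF reach_countdown[where I=I, OF _ _ body] le])
    subgoal using MaxOver.prems(2,3)[of y] unfolding I_def by simp
    subgoal using MaxOver.prems(2,3)[of y] by simp
    subgoal by assumption
    subgoal by assumption
    subgoal unfolding I_def using mL[of ?n] by (auto intro!: reach_add[simplified])
    done
qed

section \<open>Commands\<close>

datatype 'v cmd =
    Write "'v exp" "'v exp"
  | Seq "'v cmd" "'v cmd" (infixr ";;" 60)
  | When "'v exp" "'v cmd"
  | Bind 'v "'v exp" "'v cmd"
  | Loop 'v 'v "'v cmd"

primrec run :: "'v cmd \<Rightarrow> ('v \<Rightarrow> nat) \<Rightarrow> (nat \<Rightarrow> nat) \<Rightarrow> (nat \<Rightarrow> nat)" where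
  "run (Write a e) \<sigma> M = M(ev a \<sigma> M := ev e \<sigma> M)"
| "run (c ;; d) \<sigma> M = run d \<sigma> (run c \<sigma> M)"
| "run (When e c) \<sigma> M = (if ev e \<sigma> M > 0 then run c \<sigma> M else M)"
| "run (Bind x e c) \<sigma> M = run c (\<sigma>(x := ev e \<sigma> M)) M"
| "run (Loop x y c) \<sigma> M = iter (\<lambda>i. run c (\<sigma>(x := i))) (\<sigma> y) M"

text \<open>The two side conditions under which a compiled program cannot overflow: what is written to memory
stays at most \<open>X\<close>, and what is bound to a variable stays at most \<open>b\<close>. Loop indices need no condition,
as they stay below the value of another variable.\<close>

primrec in_range :: "nat \<Rightarrow> nat \<Rightarrow> 'v cmd \<Rightarrow> ('v \<Rightarrow> nat) \<Rightarrow> (nat \<Rightarrow> nat) \<Rightarrow> bool" where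
  "in_range b X (Write a e) \<sigma> M \<longleftrightarrow> ev e \<sigma> M \<le> X"
| "in_range b X (c ;; d) \<sigma> M \<longleftrightarrow> in_range b X c \<sigma> M \<and> in_range b X d \<sigma> (run c \<sigma> M)"
| "in_range b X (When e c) \<sigma> M \<longleftrightarrow> (ev e \<sigma> M > 0 \<longrightarrow> in_range b X c \<sigma> M)"
| "in_range b X (Bind x e c) \<sigma> M \<longleftrightarrow> ev e \<sigma> M \<le> b \<and> in_range b X c (\<sigma>(x := ev e \<sigma> M)) M"
| "in_range b X (Loop x y c) \<sigma> M \<longleftrightarrow>
     (\<forall>i<\<sigma> y. in_range b X c (\<sigma>(x := i)) (iter (\<lambda>i. run c (\<sigma>(x := i))) i M))"

text \<open>The register convention is that of expressions: a binder claims register \<open>k\<close>, a loop claims \<open>k\<close> for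
its countdown and \<open>k + 1\<close> for its index, and the body uses the registers above them.\<close>

primrec comp_cmd :: "'v cmd \<Rightarrow> ('v \<Rightarrow> nat) \<Rightarrow> nat \<Rightarrow> ram_prog" where
  "comp_cmd (Write a e) \<rho> k = SEQ (comp_exp a \<rho> k) (SEQ (comp_exp e \<rho> (k + 1)) (STORE k (k + 1)))"
| "comp_cmd (c ;; d) \<rho> k = SEQ (comp_cmd c \<rho> k) (comp_cmd d \<rho> k)"
| "comp_cmd (When e c) \<rho> k = SEQ (comp_exp e \<rho> k) (IFNZ k (comp_cmd c \<rho> k) SKIP)"
| "comp_cmd (Bind x e c) \<rho> k = SEQ (comp_exp e \<rho> k) (comp_cmd c (\<rho>(x := k)) (k + 1))"
| "comp_cmd (Loop x y c) \<rho> k =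
     SEQ (IMM k 0) (SEQ (ADD k k (\<rho> y)) (SEQ (IMM (k + 1) 0)
       (WHILENZ k (SEQ (comp_cmd c (\<rho>(x := k + 1)) (k + 2))
         (SEQ (IMM (k + 2) 1) (SEQ (ADD (k + 1) (k + 1) (k + 2)) (SUB k k (k + 2))))))))"

primrec cmd_time :: "nat \<Rightarrow> 'v cmd \<Rightarrow> nat" where
  "cmd_time b (Write a e) = exp_time b a + exp_time b e + 1"
| "cmd_time b (c ;; d) = cmd_time b c + cmd_time b d"
| "cmd_time b (When e c) = exp_time b e + cmd_time b c + 2"
| "cmd_time b (Bind x e c) = exp_time b e + cmd_time b c"
| "cmd_time b (Loop x y c) = 4 + b * (cmd_time b c + 4)"

primrec cmd_size :: "'v cmd \<Rightarrow> nat" where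
  "cmd_size (Write a e) = exp_size a + exp_size e"
| "cmd_size (c ;; d) = cmd_size c + cmd_size d"
| "cmd_size (When e c) = exp_size e + cmd_size c"
| "cmd_size (Bind x e c) = exp_size e + cmd_size c"
| "cmd_size (Loop x y c) = cmd_size c"

text \<open>The nesting depth of ranges is the degree of the running time as a polynomial in \<open>b\<close>.\<close>

primrec exp_depth :: "'v exp \<Rightarrow> nat" where
  "exp_depth (Var v) = 0"
| "exp_depth (Const c) = 0"
| "exp_depth (Plus a b) = max (exp_depth a) (exp_depth b)"
| "exp_depth (Minus a b) = max (exp_depth a) (exp_depth b)"
| "exp_depth (Times a b) = max (exp_depth a) (exp_depth b)"
| "exp_depth (Read a) = exp_depth a"
| "exp_depth (MaxOver x y e) = Suc (exp_depth e)"

primrec cmd_depth :: "'v cmd \<Rightarrow> nat" where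
  "cmd_depth (Write a e) = max (exp_depth a) (exp_depth e)"
| "cmd_depth (c ;; d) = max (cmd_depth c) (cmd_depth d)"
| "cmd_depth (When e c) = max (exp_depth e) (cmd_depth c)"
| "cmd_depth (Bind x e c) = max (exp_depth e) (cmd_depth c)"
| "cmd_depth (Loop x y c) = Suc (cmd_depth c)"

lemma poly_sum_bound:
  fixes b :: nat
  assumes "b \<ge> 1" "t \<le> s * b ^ i" "t' \<le> s' * b ^ j"
  shows "t + t' + c \<le> (s + s' + c) * b ^ max i j"
proof -
  have "t \<le> s * b ^ max i j" "t' \<le> s' * b ^ max i j"
    by (rule le_trans[OF assms(2)] le_trans[OF assms(3)], intro mult_left_mono power_increasing, use assms(1) in auto)+
  moreover have "c \<le> c * b ^ max i j" using assms(1) by simp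
  ultimately show ?thesis unfolding distrib_right by (intro add_mono)
qed

lemma poly_loop_bound:
  fixes b :: nat
  assumes "b \<ge> 1" "t \<le> s * b ^ i"
  shows "c + b * (t + c') \<le> (c + (s + c')) * b ^ Suc i"
proof -
  have "t + c' \<le> (s + c') * b ^ i"
    using assms unfolding distrib_right by (intro add_mono) simp_all
  then have "b * (t + c') \<le> (s + c') * b ^ Suc i"
    using mult_left_mono[of "t + c'" _ b] by (simp add: mult_ac)
  moreover have "c \<le> c * b ^ Suc i" using assms(1) by (metis le_add1 mult.right_neutral mult_le_mono2 one_le_power)
  ultimately show ?thesis unfolding distrib_right[of c] by (rule add_mono[rotated])
qed

text \<open>For \<open>b = 1\<close> the running time is the sum of the coefficients of the polynomial, and all its monomials
are at most \<open>b ^ exp_depth e\<close>.\<close>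

lemma exp_time_poly: "b \<ge> 1 \<Longrightarrow> exp_time b e \<le> exp_time 1 e * b ^ exp_depth e"
proof (induction e)
  case (MaxOver x y e)
  then show ?case
    using poly_loop_bound[of b "exp_time b e" "exp_time 1 e" "exp_depth e" 6 6] by simp
next
  case (Read e)
  then show ?case
    using poly_sum_bound[of b "exp_time b e" "exp_time 1 e" "exp_depth e" 0 0 0 1] by simp
qed (auto simp only: exp_time.simps exp_depth.simps power_0 mult_1_right intro!: poly_sum_bound)

lemma cmd_time_poly: "b \<ge> 1 \<Longrightarrow> cmd_time b c \<le> cmd_time 1 c * b ^ cmd_depth c"
proof (induction c)
  case (Loop x y c)
  then show ?case
    using poly_loop_bound[of b "cmd_time b c" "cmd_time 1 c" "cmd_depth c" 4 4] by simp
next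
  case (Seq c d)
  then show ?case
    using poly_sum_bound[of b "cmd_time b c" "cmd_time 1 c" "cmd_depth c" "cmd_time b d" "cmd_time 1 d" "cmd_depth d" 0] by simp
next
  case (Bind x e c)
  then show ?case
    using poly_sum_bound[of b "exp_time b e" "exp_time 1 e" "exp_depth e" "cmd_time b c" "cmd_time 1 c" "cmd_depth c" 0]
      exp_time_poly[of b e] by simp
qed (auto simp only: cmd_time.simps cmd_depth.simps intro!: exp_time_poly poly_sum_bound)

lemma comp_cmd_correct:
  assumes X: "2 \<le> X" "b \<le> X"
  shows "X ^ cmd_size c < L \<Longrightarrow> (\<And>v. \<rho> v < k) \<Longrightarrow> (\<And>v. R (\<rho> v) = \<sigma> v) \<Longrightarrow> (\<And>v. \<sigma> v \<le> b) \<Longrightarrow>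
    (\<And>a. M a \<le> X) \<Longrightarrow> in_range b X c \<sigma> M \<Longrightarrow>
    reach L (comp_cmd c \<rho> k) (R, M) (cmd_time b c)
      (\<lambda>R' M'. M' = run c \<sigma> M \<and> (\<forall>a. M' a \<le> X) \<and> (\<forall>i<k. R' i = R i))"
proof (induction c arbitrary: \<rho> k R \<sigma> M)
  case (Write a e)
  note sz = le_less_trans[OF power_increasing Write.prems(1)]
  note E = comp_exp_correct[OF X Write.prems(5)]
  have "ev e \<sigma> M < L"
  proof -
    have "X ^ 1 \<le> X ^ cmd_size (Write a e)"
      using X exp_size_pos[of e] by (intro power_increasing) auto
    then show ?thesis using Write.prems(1,6) by simp
  qed
  then show ?case unfolding comp_cmd.simps cmd_time.simps add.assoc
    apply -
    apply (rule reach_seq, rule reach_mono[OF E[of a _ \<rho> k _ \<sigma>] order_refl])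
    subgoal using X by (auto intro: sz)
    subgoal using Write.prems by auto
    subgoal using Write.prems by auto
    subgoal using Write.prems by auto
    apply clarify
    apply (rule reach_seq, rule reach_mono[OF E[of e _ \<rho> "k + 1" _ \<sigma>] order_refl])
    subgoal using X by (auto intro: sz)
    subgoal using Write.prems by (auto intro: less_SucI)
    subgoal using Write.prems by auto
    subgoal using Write.prems by auto
    subgoal using Write.prems by (auto intro!: reach_store[simplified])
    done
next
  case (Seq c d)
  note sz = le_less_trans[OF power_increasing Seq.prems(1)]
  show ?case unfolding comp_cmd.simps cmd_time.simps
    apply (rule reach_seq, rule reach_mono[OF Seq.IH(1)[of \<rho> k _ \<sigma>] order_refl])
    subgoal using X by (auto intro: sz)
    subgoal using Seq.prems by auto
    subgoal using Seq.prems by auto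
    subgoal using Seq.prems by auto
    subgoal using Seq.prems by auto
    subgoal using Seq.prems by auto
    apply clarify
    apply (rule reach_mono[OF Seq.IH(2)[of \<rho> k _ \<sigma>] order_refl])
    subgoal using X by (auto intro: sz)
    subgoal using Seq.prems by auto
    subgoal using Seq.prems by auto
    subgoal using Seq.prems by auto
    subgoal using Seq.prems by auto
    subgoal using Seq.prems by auto
    subgoal by auto
    done
next
  case (When e c)
  note sz = le_less_trans[OF power_increasing When.prems(1)]
  have T: "cmd_time b (When e c) = exp_time b e + Suc (cmd_time b c + 1)" by simp
  show ?case unfolding comp_cmd.simps T
    apply (rule reach_seq, rule reach_mono[OF comp_exp_correct[OF X When.prems(5), of e _ \<rho> k _ \<sigma>] order_refl])
    subgoal using X by (auto intro: sz)
    subgoal using When.prems by auto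
    subgoal using When.prems by auto
    subgoal using When.prems by auto
    apply clarify
    apply (rule reach_if)
    apply (cases "ev e \<sigma> M > 0")
    subgoal
      apply simp
      apply (rule reach_mono[OF When.IH[of \<rho> k _ \<sigma>]])
      subgoal using X by (auto intro: sz)
      subgoal using When.prems by auto
      subgoal using When.prems by auto
      subgoal using When.prems by auto
      subgoal using When.prems by auto
      subgoal using When.prems by auto
      subgoal by simp
      subgoal by auto
      done
    subgoal using When.prems by (auto intro!: reach_mono[OF reach_skip[where Q="\<lambda>R' M'. R' = _ \<and> M' = _"]])
    done
next
  case (Bind x e c)
  note sz = le_less_trans[OF power_increasing Bind.prems(1)]
  show ?case unfolding comp_cmd.simps cmd_time.simps
    apply (rule reach_seq, rule reach_mono[OF comp_exp_correct[OF X Bind.prems(5), of e _ \<rho> k _ \<sigma>] order_refl])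
    subgoal using X by (auto intro: sz)
    subgoal using Bind.prems by auto
    subgoal using Bind.prems by auto
    subgoal using Bind.prems by auto
    apply clarify
    apply (rule reach_mono[OF Bind.IH[of _ _ _ "\<sigma>(x := ev e \<sigma> M)"] order_refl])
    subgoal using X by (auto intro: sz)
    subgoal using Bind.prems by (auto intro: less_SucI)
    subgoal using Bind.prems by auto
    subgoal using Bind.prems by auto
    subgoal using Bind.prems by auto
    subgoal using Bind.prems(6) by (simp add: fun_upd_def)
    subgoal by (auto simp: fun_upd_def)
    done
next
  case (Loop x y c)
  let ?n = "\<sigma> y" and ?f = "\<lambda>i. run c (\<sigma>(x := i))"
  have n: "?n \<le> b" by (rule Loop.prems(4))
  have XL: "X ^ cmd_size c < L" using Loop.prems(1) by simp
  have "X ^ 1 \<le> X ^ cmd_size c"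
  proof (rule power_increasing)
    show "1 \<le> cmd_size c" by (induction c) (auto simp: Suc_le_eq exp_size_pos)
  qed (use X in simp)
  then have L: "X < L" "1 < L" "b < L" using XL X by simp_all
  define I where "I j R' M' \<longleftrightarrow> (\<forall>i<k. R' i = R i) \<and> j \<le> ?n \<and> R' (k + 1) = ?n - j \<and>
    M' = iter ?f (?n - j) M \<and> (\<forall>a. M' a \<le> X)" for j R' M'
  let ?body = "SEQ (comp_cmd c (\<rho>(x := k + 1)) (k + 2))
         (SEQ (IMM (k + 2) 1) (SEQ (ADD (k + 1) (k + 1) (k + 2)) (SUB k k (k + 2))))"
  have body: "reach L ?body (R', M') (cmd_time b c + 3) (\<lambda>R' M'. I j R' M' \<and> R' k = j)"
    if I: "I (Suc j) R' M'" and j: "R' k = Suc j" for j R' M'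
  proof -
    let ?i = "?n - Suc j"
    have jn: "Suc j \<le> ?n" "?n - j = Suc ?i" "?i < ?n" using I unfolding I_def by auto
    have e: "reach L (comp_cmd c (\<rho>(x := k + 1)) (k + 2)) (R', M') (cmd_time b c)
      (\<lambda>R'' M''. M'' = ?f ?i M' \<and> (\<forall>a. M'' a \<le> X) \<and> (\<forall>i<k + 2. R'' i = R' i))"
    proof (rule Loop.IH[OF XL])
      show "(\<rho>(x := k + 1)) v < k + 2" for v using Loop.prems(2)[of v] by auto
      show "R' ((\<rho>(x := k + 1)) v) = (\<sigma>(x := ?i)) v" for v
        using Loop.prems(2,3)[of v] I unfolding I_def by auto
      show "(\<sigma>(x := ?i)) v \<le> b" for v using Loop.prems(4)[of v] n by auto
      show "M' a \<le> X" for a using I unfolding I_def by blast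
      show "in_range b X c (\<sigma>(x := ?i)) M'" using I jn Loop.prems(6) unfolding I_def by auto
    qed
    have three: "cmd_time b c + 3 = cmd_time b c + Suc (Suc 1)" by simp
    show ?thesis unfolding three
      apply (rule reach_seq, rule reach_mono[OF e order_refl], clarify)
      apply (rule reach_seq1, rule reach_imm)
      subgoal using L by simp
      apply (rule reach_seq1, rule reach_add)
      subgoal using I jn n L unfolding I_def by simp
      apply (rule reach_sub)
      subgoal using I jn n L j unfolding I_def by simp
      subgoal using I jn j unfolding I_def by simp
      done
  qed
  have T: "cmd_time b (Loop x y c) = Suc (Suc (Suc (1 + b * (cmd_time b c + 3 + 1))))"
    by simp
  have le: "1 + ?n * (cmd_time b c + 3 + 1) \<le> 1 + b * (cmd_time b c + 3 + 1)" using n by simp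
  show ?case unfolding comp_cmd.simps T
    apply (rule reach_seq1, rule reach_imm)
    subgoal using L by simp
    apply (rule reach_seq1, rule reach_add)
    subgoal using L n Loop.prems(2,3)[of y] by simp
    apply (rule reach_seq1, rule reach_imm)
    subgoal using L by simp
    apply (rule reach_mono[OF reach_countdown[where I=I, OF _ _ body] le])
    subgoal using Loop.prems(2,3)[of y] Loop.prems(5) unfolding I_def by simp
    subgoal using Loop.prems(2,3)[of y] by simp
    subgoal by assumption
    subgoal by assumption
    subgoal unfolding I_def by auto
    done
qed

section \<open>Weakest preconditions\<close>

text \<open>Since evaluation is total, a weakest precondition is the conjunction of the range conditions with
the postcondition of the final memory. It reduces the verification of a program to invariants of
its loops; running time and registers no longer occur.\<close>

definition wp :: "nat \<Rightarrow> nat \<Rightarrow> 'v cmd \<Rightarrow> ('v \<Rightarrow> nat) \<Rightarrow> ((nat \<Rightarrow> nat) \<Rightarrow> bool) \<Rightarrow> (nat \<Rightarrow> nat) \<Rightarrow> bool" where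
  "wp b X c \<sigma> Q M \<longleftrightarrow> in_range b X c \<sigma> M \<and> Q (run c \<sigma> M)"

lemma wp_simps:
  "wp b X (Write a e) \<sigma> Q M \<longleftrightarrow> ev e \<sigma> M \<le> X \<and> Q (M(ev a \<sigma> M := ev e \<sigma> M))"
  "wp b X (c ;; d) \<sigma> Q M \<longleftrightarrow> wp b X c \<sigma> (wp b X d \<sigma> Q) M"
  "wp b X (When e c) \<sigma> Q M \<longleftrightarrow> (if ev e \<sigma> M > 0 then wp b X c \<sigma> Q M else Q M)"
  "wp b X (Bind x e c) \<sigma> Q M \<longleftrightarrow> ev e \<sigma> M \<le> b \<and> wp b X c (\<sigma>(x := ev e \<sigma> M)) Q M"
  by (auto simp: wp_def)

lemma wp_mono: "wp b X c \<sigma> Q M \<Longrightarrow> (\<And>M. Q M \<Longrightarrow> Q' M) \<Longrightarrow> wp b X c \<sigma> Q' M"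
  by (auto simp: wp_def)

lemma wp_loop:
  assumes "I 0 M"
    and "\<And>i M. i < \<sigma> y \<Longrightarrow> I i M \<Longrightarrow> wp b X c (\<sigma>(x := i)) (I (Suc i)) M"
    and "\<And>M. I (\<sigma> y) M \<Longrightarrow> Q M"
  shows "wp b X (Loop x y c) \<sigma> Q M"
proof -
  let ?M = "\<lambda>i. iter (\<lambda>i. run c (\<sigma>(x := i))) i M"
  have I: "I i (?M i)" if "i \<le> \<sigma> y" for i
    using that by (induction i) (use assms(1,2) in \<open>auto simp: wp_def Suc_le_eq\<close>)
  then have "in_range b X c (\<sigma>(x := i)) (?M i)" if "i < \<sigma> y" for i
    using assms(2)[OF that, of "?M i"] that by (simp add: wp_def)
  then show ?thesis using assms(3)[OF I] by (simp add: wp_def)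
qed

section \<open>Trees grown leaf by leaf\<close>

text \<open>A tree is described by the list of its vertices other than the root \<open>z\<close> in the order of a search,
the last one first, each paired with the neighbour from which it was reached. Removing the head of
the list removes a leaf.\<close>

fun verts :: "'a \<Rightarrow> ('a \<times> 'a) list \<Rightarrow> 'a set" where
  "verts z [] = {z}"
| "verts z ((c, r) # ps) = insert c (verts z ps)"

fun growth :: "'a \<Rightarrow> ('a \<times> 'a) list \<Rightarrow> bool" where
  "growth z [] \<longleftrightarrow> True"
| "growth z ((c, r) # ps) \<longleftrightarrow> growth z ps \<and> c \<notin> verts z ps \<and> r \<in> verts z ps"

definition edges :: "('a \<times> 'a) list \<Rightarrow> 'a set set" where
  "edges ps = (\<lambda>(c, r). {c, r}) ` set ps"

text \<open>A new leaf \<open>c\<close> is one step further than its neighbour \<open>r\<close> from every older vertex.\<close>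

fun tdist :: "('a \<times> 'a) list \<Rightarrow> 'a \<Rightarrow> 'a \<Rightarrow> nat" where
  "tdist [] x y = 0"
| "tdist ((c, r) # ps) x y =
     (if x = c then if y = c then 0 else Suc (tdist ps r y)
      else if y = c then Suc (tdist ps x r) else tdist ps x y)"

lemma edges_simps [simp]:
  "edges [] = {}" "edges ((c, r) # ps) = insert {c, r} (edges ps)"
  by (auto simp: edges_def)

lemma root_in_verts [simp]: "z \<in> verts z ps"
  by (induction ps) auto

lemma finite_verts [simp]: "finite (verts z ps)"
  by (induction ps) auto

lemma card_verts: "growth z ps \<Longrightarrow> card (verts z ps) = Suc (length ps)"
  by (induction ps) auto

lemma tdist_refl [simp]: "tdist ps x x = 0"
  by (induction ps) auto

lemma tdist_sym: "tdist ps x y = tdist ps y x"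
  by (induction ps arbitrary: x y) auto

lemma tdist_le_length: "tdist ps x y \<le> length ps"
  by (induction ps arbitrary: x y) (auto simp: le_SucI)

lemma edges_verts: "growth z ps \<Longrightarrow> {u, v} \<in> edges ps \<Longrightarrow> u \<in> verts z ps \<and> v \<in> verts z ps"
  by (induction ps) (auto simp: doubleton_eq_iff)

text \<open>Going along an edge changes the distance from \<open>x\<close> by at most one; so no walk is shorter than
\<open>tdist\<close> predicts.\<close>

lemma tdist_lipschitz:
  "growth z ps \<Longrightarrow> {u, v} \<in> edges ps \<Longrightarrow> x \<in> verts z ps \<Longrightarrow> tdist ps x v \<le> Suc (tdist ps x u)"
proof (induction ps arbitrary: x u v)
  case (Cons p ps)
  obtain c r where p: "p = (c, r)" by (cases p)
  show ?case
  proof (cases "{u, v} \<in> edges ps")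
    case True
    then have "u \<in> verts z ps" "v \<in> verts z ps" using edges_verts Cons.prems(1) p by fastforce+
    then have "u \<noteq> c" "v \<noteq> c" using Cons.prems(1) p by auto
    then show ?thesis using Cons.IH[of u v] Cons.prems True p by auto
  next
    case False
    then have "(u = c \<and> v = r) \<or> (u = r \<and> v = c)"
      using Cons.prems(2) p by (auto simp: doubleton_eq_iff)
    then show ?thesis by (auto simp: p)
  qed
qed simp

lemma tdist_walk_le:
  assumes "growth z ps" "x \<in> verts z ps"
  shows "p \<noteq> [] \<Longrightarrow> successively (\<lambda>u v. {u, v} \<in> edges ps) p \<Longrightarrow>
    tdist ps x (last p) + 1 \<le> tdist ps x (hd p) + length p"
proof (induction p)
  case (Cons u p)
  show ?case
  proof (cases p)
    case (Cons v q)
    then have "tdist ps x v \<le> Suc (tdist ps x u)"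
      using Cons.prems assms by (intro tdist_lipschitz) auto
    then show ?thesis using Cons.IH Cons.prems Cons by auto
  qed simp
qed simp

text \<open>Following the recursion of \<open>tdist\<close> extends a path at one end by a vertex that is not yet on it, so
the walk of the predicted length is even a path. Distinctness is what makes it part of a cycle
below.\<close>

lemma tdist_path:
  "growth z ps \<Longrightarrow> x \<in> verts z ps \<Longrightarrow> y \<in> verts z ps \<Longrightarrow>
   \<exists>p. walk_betw (verts z ps) (edges ps) x p y \<and> distinct p \<and> length p = Suc (tdist ps x y)"
proof (induction ps arbitrary: x y)
  case Nil
  then show ?case by (intro exI[of _ "[z]"]) (auto simp: walk_betw_def)
next
  case (Cons e ps)
  obtain c r where e: "e = (c, r)" by (cases e)
  have g: "growth z ps" "c \<notin> verts z ps" "r \<in> verts z ps" using Cons.prems e by auto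
  have lift: "walk_betw (verts z (e # ps)) (edges (e # ps)) u p v"
    if "walk_betw (verts z ps) (edges ps) u p v" for u p v
    using that e unfolding walk_betw_def by (auto intro: successively_mono)
  consider "x = c" "y = c" | "x = c" "y \<in> verts z ps" | "x \<in> verts z ps" "y = c"
    | "x \<in> verts z ps" "y \<in> verts z ps"
    using Cons.prems e by auto
  then show ?case
  proof cases
    case 1
    then show ?thesis by (intro exI[of _ "[c]"]) (auto simp: walk_betw_def e)
  next
    case 2
    obtain p where p: "walk_betw (verts z ps) (edges ps) r p y" "distinct p"
      "length p = Suc (tdist ps r y)"
      using Cons.IH[OF g(1) g(3) 2(2)] by blast
    then show ?thesis using 2 g lift[OF p(1)]
      by (intro exI[of _ "c # p"]) (auto simp: walk_betw_def e successively_Cons)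
  next
    case 3
    obtain p where p: "walk_betw (verts z ps) (edges ps) x p r" "distinct p"
      "length p = Suc (tdist ps x r)"
      using Cons.IH[OF g(1) 3(1) g(3)] by blast
    then show ?thesis using 3 g lift[OF p(1)]
      by (intro exI[of _ "p @ [c]"])
        (auto simp: walk_betw_def e successively_append_iff insert_commute)
  next
    case 4
    obtain p where p: "walk_betw (verts z ps) (edges ps) x p y" "distinct p"
      "length p = Suc (tdist ps x y)"
      using Cons.IH[OF g(1) 4] by blast
    moreover have "tdist (e # ps) x y = tdist ps x y" using 4 g by (auto simp: e)
    ultimately show ?thesis using lift[OF p(1)] by metis
  qed
qed

lemma gdist_eq_tdist:
  assumes "growth z ps" "x \<in> verts z ps" "y \<in> verts z ps"
  shows "gdist (verts z ps) (edges ps) x y = tdist ps x y"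
  unfolding gdist_def
proof (rule Least_equality)
  show "\<exists>p. walk_betw (verts z ps) (edges ps) x p y \<and> length p = Suc (tdist ps x y)"
    using tdist_path[OF assms] by blast
next
  fix k assume "\<exists>p. walk_betw (verts z ps) (edges ps) x p y \<and> length p = Suc k"
  then obtain p where "walk_betw (verts z ps) (edges ps) x p y" "length p = Suc k" by blast
  then show "tdist ps x y \<le> k"
    using tdist_walk_le[OF assms(1,2), of p] by (auto simp: walk_betw_def)
qed

text \<open>An edge outside the search tree would close a cycle with the path between its ends.\<close>

lemma tree_edges_eq_growth:
  assumes T: "is_tree (verts z ps) E" and g: "growth z ps" and sub: "edges ps \<subseteq> E"
  shows "E = edges ps"
proof (rule ccontr)
  assume "E \<noteq> edges ps"
  then obtain e where e: "e \<in> E" "e \<notin> edges ps" using sub by blast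
  then have "card e = 2" "e \<subseteq> verts z ps"
    using T unfolding is_tree_def simple_graph_def by auto
  then obtain u v where uv: "e = {u, v}" "u \<noteq> v" "u \<in> verts z ps" "v \<in> verts z ps"
    by (auto simp: card_2_iff)
  obtain p where p: "walk_betw (verts z ps) (edges ps) u p v" "distinct p"
    using tdist_path[OF g uv(3,4)] by blast
  have "length p \<ge> 3"
  proof (rule ccontr)
    assume "\<not> length p \<ge> 3"
    then have "length p = 0 \<or> length p = 1 \<or> length p = 2" by linarith
    then show False
      using p(1) uv e by (auto simp: walk_betw_def length_Suc_conv numeral_2_eq_2)
  qed
  moreover have "successively (\<lambda>a b. {a, b} \<in> E) p"
    using p(1) sub unfolding walk_betw_def by (auto elim: successively_mono)
  ultimately have "is_cycle (verts z ps) E p"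
    using p uv e unfolding walk_betw_def is_cycle_def by (auto simp: insert_commute)
  then show False using T unfolding is_tree_def by blast
qed

lemma walk_leaves_set:
  "successively (\<lambda>u v. {u, v} \<in> E) p \<Longrightarrow> p \<noteq> [] \<Longrightarrow> set p \<subseteq> V \<Longrightarrow> hd p \<in> S \<Longrightarrow> last p \<notin> S \<Longrightarrow>
   \<exists>u\<in>S. \<exists>v\<in>V - S. {u, v} \<in> E"
proof (induction p)
  case (Cons a p)
  show ?case
  proof (cases "p = [] \<or> hd p \<in> S")
    case True
    then show ?thesis
    proof (cases "p = []")
      case False
      then have "hd p \<in> S" "successively (\<lambda>u v. {u, v} \<in> E) p" "last p \<notin> S" "set p \<subseteq> V"
        using True Cons.prems by (auto simp: successively_Cons)
      then show ?thesis using Cons.IH False by blast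
    qed (use Cons.prems in auto)
  next
    case False
    then have "{a, hd p} \<in> E" "hd p \<in> V - S" "a \<in> S"
      using Cons.prems by (auto simp: successively_Cons dest: hd_in_set)
    then show ?thesis by blast
  qed
qed simp

text \<open>A search of a connected graph can only stop when it has found all vertices.\<close>

lemma crossing_edge:
  assumes "connected_graph V E" "S \<subset> V" "S \<noteq> {}"
  shows "\<exists>u\<in>S. \<exists>v\<in>V - S. {u, v} \<in> E"
proof -
  obtain x y where "x \<in> S" "y \<in> V" "y \<notin> S" "x \<in> V" using assms(2,3) by blast
  moreover from this obtain p where "walk_betw V E x p y"
    using assms(1) unfolding connected_graph_def by blast
  ultimately show ?thesis using walk_leaves_set[of E p V S] by (auto simp: walk_betw_def)
qed

lemma tree_growth_exists:
  assumes T: "is_tree V E" and z: "z \<in> V"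
  obtains ps where "growth z ps" "verts z ps = V" "E = edges ps"
proof -
  have fin: "finite V" and conn: "connected_graph V E"
    using T unfolding is_tree_def simple_graph_def by auto
  have "\<exists>ps. growth z ps \<and> edges ps \<subseteq> E \<and> verts z ps \<subseteq> V \<and> length ps = k" if "k < card V" for k
    using that
  proof (induction k)
    case 0
    then show ?case using z by (intro exI[of _ "[]"]) auto
  next
    case (Suc k)
    then obtain ps where ps: "growth z ps" "edges ps \<subseteq> E" "verts z ps \<subseteq> V" "length ps = k"
      by auto
    then have "verts z ps \<noteq> V" using Suc.prems card_verts by fastforce
    then obtain u v where "u \<in> verts z ps" "v \<in> V - verts z ps" "{u, v} \<in> E"
      using crossing_edge[OF conn, of "verts z ps"] ps(3) root_in_verts[of z ps] by blast
    then show ?case using ps by (intro exI[of _ "(v, u) # ps"]) (auto simp: insert_commute)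
  qed
  moreover have "card V > 0" using fin z card_gt_0_iff by blast
  ultimately obtain ps where ps: "growth z ps" "edges ps \<subseteq> E" "verts z ps \<subseteq> V" "length ps = card V - 1"
    using that by (metis One_nat_def diff_less zero_less_one)
  have "verts z ps = V"
    using ps card_verts[OF ps(1)] \<open>card V > 0\<close> fin by (intro card_subset_eq) auto
  then show ?thesis using that[OF ps(1)] tree_edges_eq_growth[of z ps E] T ps by auto
qed

lemma card_edges_le: "card (edges ps) \<le> length ps"
  unfolding edges_def by (meson List.finite_set card_image_le card_length le_trans)

lemma growth_drop: "growth z ps \<Longrightarrow> growth z (drop k ps)"
proof (induction ps arbitrary: k)
  case (Cons a ps)
  then show ?case by (cases k; cases a) auto
qed simp

lemma verts_drop_subset: "verts z (drop k ps) \<subseteq> verts z ps"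
proof (induction ps arbitrary: k)
  case (Cons a ps)
  show ?case
  proof (cases k)
    case (Suc j)
    then show ?thesis using Cons.IH[of j] by (cases a) auto
  qed simp
qed simp

text \<open>Leaves that are added later do not change old distances.\<close>

lemma tdist_drop:
  assumes "growth z ps"
  shows "x \<in> verts z (drop k ps) \<Longrightarrow> y \<in> verts z (drop k ps) \<Longrightarrow> tdist ps x y = tdist (drop k ps) x y"
  using assms
proof (induction ps arbitrary: k)
  case (Cons e ps)
  obtain c r where e: "e = (c, r)" by (cases e)
  show ?case
  proof (cases k)
    case (Suc j)
    show ?thesis using Cons.IH[of j] Cons.prems Suc e verts_drop_subset[of z j ps] by auto
  qed simp
qed simp

section \<open>Optimal weights on clusters\<close>

text \<open>An independent broadcast \<open>f\<close> restricted to a part \<open>C\<close> of the tree that is attached to the rest through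
the vertex \<open>r\<close>. The bound \<open>e\<close> stands for the eccentricity. What the rest needs to know about \<open>f\<close> are
two numbers: \<open>q\<close> bounds from below how deep below \<open>r\<close> its support starts, and \<open>p\<close> bounds how far its
balls reach beyond \<open>r\<close>.\<close>

definition feasible ::
  "('a \<Rightarrow> 'a \<Rightarrow> nat) \<Rightarrow> ('a \<Rightarrow> nat) \<Rightarrow> 'a set \<Rightarrow> 'a \<Rightarrow> nat \<Rightarrow> nat \<Rightarrow> ('a \<Rightarrow> nat) \<Rightarrow> bool" where
  "feasible d e C r q p f \<longleftrightarrow>
     (\<forall>x\<in>C. f x \<le> e x) \<and>
     (\<forall>x\<in>C. \<forall>y\<in>C. x \<noteq> y \<and> f x > 0 \<and> f y > 0 \<longrightarrow> d x y > max (f x) (f y)) \<and>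
     (\<forall>x\<in>C. f x > 0 \<longrightarrow> q \<le> d r x \<and> f x \<le> p + d r x)"

definition opt ::
  "('a \<Rightarrow> 'a \<Rightarrow> nat) \<Rightarrow> ('a \<Rightarrow> nat) \<Rightarrow> 'a set \<Rightarrow> 'a \<Rightarrow> nat \<Rightarrow> nat \<Rightarrow> nat" where
  "opt d e C r q p = Max {(\<Sum>x\<in>C. f x) | f. feasible d e C r q p f}"

lemma feasible_weights_finite: "finite {(\<Sum>x\<in>C. f x) | f. feasible d e C r q p f}"
proof (rule finite_subset)
  show "{(\<Sum>x\<in>C. f x) | f. feasible d e C r q p f} \<subseteq> {..\<Sum>x\<in>C. e x}"
    by (auto simp: feasible_def intro!: sum_mono)
qed simp

lemma opt_upper: "feasible d e C r q p f \<Longrightarrow> (\<Sum>x\<in>C. f x) \<le> opt d e C r q p"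
  unfolding opt_def by (intro Max_ge feasible_weights_finite) auto

lemma opt_attained:
  obtains f where "feasible d e C r q p f" "(\<Sum>x\<in>C. f x) = opt d e C r q p"
proof -
  have "feasible d e C r q p (\<lambda>_. 0)" by (simp add: feasible_def)
  then have "opt d e C r q p \<in> {(\<Sum>x\<in>C. f x) | f. feasible d e C r q p f}"
    unfolding opt_def by (intro Max_in feasible_weights_finite) auto
  then show ?thesis using that by auto
qed

lemma opt_le_sum: "opt d e C r q p \<le> (\<Sum>x\<in>C. e x)"
proof -
  obtain f where "feasible d e C r q p f" "(\<Sum>x\<in>C. f x) = opt d e C r q p"
    by (rule opt_attained)
  then show ?thesis by (metis feasible_def sum_mono)
qed

lemma opt_singleton:
  assumes "d v v = 0"
  shows "opt d e {v} v q p = (if q = 0 then min p (e v) else 0)"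
proof (rule antisym)
  obtain f where "feasible d e {v} v q p f" "(\<Sum>x\<in>{v}. f x) = opt d e {v} v q p"
    by (rule opt_attained)
  then show "opt d e {v} v q p \<le> (if q = 0 then min p (e v) else 0)"
    using assms by (auto simp: feasible_def)
  have "feasible d e {v} v q p (\<lambda>_. if q = 0 then min p (e v) else 0)"
    using assms by (auto simp: feasible_def)
  from opt_upper[OF this] show "(if q = 0 then min p (e v) else 0) \<le> opt d e {v} v q p"
    by simp
qed

text \<open>The recurrence of the dynamic program. Attaching a part through an edge below \<open>r\<close> shifts its depths
by one, which turns \<open>q\<close> into \<open>q - 1\<close> and \<open>p\<close> into \<open>p + 1\<close>. If the supports start at depths at least
\<open>s = max q i\<close> and \<open>t = max (q - 1) j\<close>, then the balls of the first part may reach at most \<open>t\<close> beyond \<open>r\<close>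
and those of the second part at most \<open>s\<close> beyond its own root; the minima express this. Taking
the maximum over all \<open>i\<close> and \<open>j\<close> while clipping with \<open>max\<close> avoids any case distinction.\<close>

definition merge :: "nat \<Rightarrow> (nat \<Rightarrow> nat \<Rightarrow> nat) \<Rightarrow> (nat \<Rightarrow> nat \<Rightarrow> nat) \<Rightarrow> nat \<Rightarrow> nat \<Rightarrow> nat" where
  "merge N A A' q p = mx (\<lambda>i. mx (\<lambda>j.
     A (max q i) (min p (max (q - 1) j)) + A' (max (q - 1) j) (min (p + 1) (max q i))) (N + 1)) (N + 1)"

lemma merge_upper:
  assumes "i \<le> N" "j \<le> N"
  shows "A (max q i) (min p (max (q - 1) j)) + A' (max (q - 1) j) (min (p + 1) (max q i)) \<le> merge N A A' q p"
proof -
  have "A (max q i) (min p (max (q - 1) j)) + A' (max (q - 1) j) (min (p + 1) (max q i))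
    \<le> mx (\<lambda>j. A (max q i) (min p (max (q - 1) j)) + A' (max (q - 1) j) (min (p + 1) (max q i))) (N + 1)"
    using mx_upper[of j "N + 1" "\<lambda>j. A (max q i) (min p (max (q - 1) j)) + A' (max (q - 1) j) (min (p + 1) (max q i))"]
      assms by simp
  also have "\<dots> \<le> merge N A A' q p"
    unfolding merge_def
    by (rule mx_upper[of i _ "\<lambda>i. mx (\<lambda>j. A (max q i) (min p (max (q - 1) j)) + A' (max (q - 1) j) (min (p + 1) (max q i))) (N + 1)"])
      (use assms in simp)
  finally show ?thesis .
qed

text \<open>An empty support starts at the depth \<open>N\<close>, which is too large to restrict anything.\<close>

lemma least_depth:
  assumes "finite S" "\<And>x. x \<in> S \<Longrightarrow> d x \<le> (N::nat)"
  obtains i where "i \<le> N" "\<And>x. x \<in> S \<Longrightarrow> i \<le> d x" "S = {} \<Longrightarrow> i = N" "S \<noteq> {} \<Longrightarrow> \<exists>x\<in>S. d x = i"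
proof (cases "S = {}")
  case True
  then show ?thesis using that[of N] by auto
next
  case False
  have "Min (d ` S) \<in> d ` S" using assms(1) False by (intro Min_in) auto
  then obtain x where x: "x \<in> S" "d x = Min (d ` S)" by auto
  then have "d x \<le> d y" if "y \<in> S" for y using assms(1) that by simp
  then show ?thesis using that[of "d x"] x(1) assms(2) by auto
qed

text \<open>For \<open>x\<close> in the upper part and \<open>y\<close> in the lower part, the distance is \<open>d r x + 1 + d c y\<close>. An optimal
broadcast on the union yields a term of the recurrence if \<open>i\<close> and \<open>j\<close> are the exact depths at which
its two supports start: \<open>f x < d x y\<close> for the \<open>y\<close> of least depth says that \<open>x\<close> reaches at most \<open>j\<close> beyond \<open>r\<close>.
Conversely, the minima in a term of the recurrence force all pairs across the edge to be far enough
apart, so that two optimal broadcasts on the parts can be combined.\<close>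

lemma opt_merge:
  assumes fin: "finite C" "finite C'" and disj: "C \<inter> C' = {}"
    and sym: "\<And>x y. d x y = d y x"
    and across: "\<And>x y. x \<in> C \<Longrightarrow> y \<in> C' \<Longrightarrow> d x y = d r x + 1 + d c y"
    and down: "\<And>y. y \<in> C' \<Longrightarrow> d r y = d c y + 1"
    and dN: "\<And>x. x \<in> C \<Longrightarrow> d r x \<le> N" "\<And>y. y \<in> C' \<Longrightarrow> d c y \<le> N"
    and eN: "\<And>x. x \<in> C \<union> C' \<Longrightarrow> e x \<le> N"
  shows "opt d e (C \<union> C') r q p = merge N (opt d e C r) (opt d e C' c) q p"
proof (rule antisym)
  obtain f where f: "feasible d e (C \<union> C') r q p f"
    and w: "(\<Sum>x\<in>C \<union> C'. f x) = opt d e (C \<union> C') r q p"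
    by (rule opt_attained)
  have f1: "\<And>x. x \<in> C \<union> C' \<Longrightarrow> f x \<le> e x"
    and f2: "\<And>x y. x \<in> C \<union> C' \<Longrightarrow> y \<in> C \<union> C' \<Longrightarrow> x \<noteq> y \<Longrightarrow> f x > 0 \<Longrightarrow> f y > 0 \<Longrightarrow>
      max (f x) (f y) < d x y"
    and f3: "\<And>x. x \<in> C \<union> C' \<Longrightarrow> f x > 0 \<Longrightarrow> q \<le> d r x \<and> f x \<le> p + d r x"
    using f unfolding feasible_def by simp_all
  \<comment> \<open>The supports on the two sides and the depths at which they start.\<close>
  define S where "S = {x\<in>C. f x > 0}"
  define S' where "S' = {x\<in>C'. f x > 0}"
  obtain i where i: "i \<le> N" "\<And>x. x \<in> S \<Longrightarrow> i \<le> d r x" "S = {} \<Longrightarrow> i = N" "S \<noteq> {} \<Longrightarrow> \<exists>x\<in>S. d r x = i"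
    using least_depth[of S "d r" N] fin dN unfolding S_def by auto
  obtain j where j: "j \<le> N" "\<And>x. x \<in> S' \<Longrightarrow> j \<le> d c x" "S' = {} \<Longrightarrow> j = N" "S' \<noteq> {} \<Longrightarrow> \<exists>x\<in>S'. d c x = j"
    using least_depth[of S' "d c" N] fin dN unfolding S'_def by auto
  have fN: "f x \<le> N" if "x \<in> C \<union> C'" for x
  proof -
    show ?thesis using eN[OF that] f1[OF that] by simp
  qed
  have sep: "f x < d x y \<and> f y < d x y" if "x \<in> S" "y \<in> S'" for x y
    
  proof -
    have "x \<in> C \<union> C'" "y \<in> C \<union> C'" "x \<noteq> y" "f x > 0" "f y > 0"
      using that disj unfolding S_def S'_def by auto
    from f2[OF this] have "max (f x) (f y) < d x y" .
    then show ?thesis by simp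
  qed
  have xj: "f x \<le> j + d r x" if "x \<in> S" for x
  proof (cases "S' = {}")
    case True
    then show ?thesis using j(3) fN[of x] that unfolding S_def by simp
  next
    case False
    then obtain y where y: "y \<in> S'" "d c y = j" using j(4) by blast
    then show ?thesis using sep[OF that y(1)] across[of x y] that unfolding S_def S'_def by simp
  qed
  have yi: "f y \<le> i + d c y" if "y \<in> S'" for y
  proof (cases "S = {}")
    case True
    then show ?thesis using i(3) fN[of y] that unfolding S'_def by simp
  next
    case False
    then obtain x where x: "x \<in> S" "d r x = i" using i(4) by blast
    then show ?thesis using sep[OF x(1) that] across[of x y] that unfolding S_def S'_def by simp
  qed
  have "feasible d e C r (max q i) (min p (max (q - 1) j)) f"
  proof -
    have "max q i \<le> d r x \<and> f x \<le> min p (max (q - 1) j) + d r x" if "x \<in> C" "f x > 0" for x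
    proof -
      have "q \<le> d r x" "f x \<le> p + d r x" using f3[of x] that by auto
      moreover have "i \<le> d r x" "f x \<le> j + d r x" using i(2)[of x] xj[of x] that unfolding S_def by auto
      ultimately show ?thesis by linarith
    qed
    then show ?thesis using f1 f2 unfolding feasible_def by simp
  qed
  moreover have "feasible d e C' c (max (q - 1) j) (min (p + 1) (max q i)) f"
  proof -
    have "max (q - 1) j \<le> d c y \<and> f y \<le> min (p + 1) (max q i) + d c y"
      if "y \<in> C'" "f y > 0" for y
    proof -
      have "q \<le> d r y" "f y \<le> p + d r y" using f3[of y] that by auto
      moreover have "j \<le> d c y" "f y \<le> i + d c y" using j(2)[of y] yi[of y] that unfolding S'_def by auto
      ultimately show ?thesis using down[OF that(1)] by linarith
    qed
    then show ?thesis using f1 f2 unfolding feasible_def by simp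
  qed
  ultimately have "(\<Sum>x\<in>C. f x) + (\<Sum>x\<in>C'. f x)
    \<le> opt d e C r (max q i) (min p (max (q - 1) j)) + opt d e C' c (max (q - 1) j) (min (p + 1) (max q i))"
    by (intro add_mono opt_upper)
  also have "\<dots> \<le> merge N (opt d e C r) (opt d e C' c) q p"
    using i(1) j(1) by (rule merge_upper)
  finally show "opt d e (C \<union> C') r q p \<le> merge N (opt d e C r) (opt d e C' c) q p"
    using w fin disj by (simp add: sum.union_disjoint)
next
  show "merge N (opt d e C r) (opt d e C' c) q p \<le> opt d e (C \<union> C') r q p"
    unfolding merge_def
  proof (intro mx_least)
    fix i j
    define s where "s = max q i"
    define t where "t = max (q - 1) j"
    obtain f where f: "feasible d e C r s (min p t) f" "(\<Sum>x\<in>C. f x) = opt d e C r s (min p t)"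
      by (rule opt_attained)
    obtain g where g: "feasible d e C' c t (min (p + 1) s) g" "(\<Sum>x\<in>C'. g x) = opt d e C' c t (min (p + 1) s)"
      by (rule opt_attained)
    have f1: "\<And>x. x \<in> C \<Longrightarrow> f x \<le> e x"
      and f2: "\<And>x y. x \<in> C \<Longrightarrow> y \<in> C \<Longrightarrow> x \<noteq> y \<Longrightarrow> f x > 0 \<Longrightarrow> f y > 0 \<Longrightarrow> max (f x) (f y) < d x y"
      and f3: "\<And>x. x \<in> C \<Longrightarrow> f x > 0 \<Longrightarrow> s \<le> d r x \<and> f x \<le> p + d r x \<and> f x \<le> t + d r x"
      using f(1) unfolding feasible_def by (simp_all add: min_add_distrib_left)
    have g1: "\<And>x. x \<in> C' \<Longrightarrow> g x \<le> e x"
      and g2: "\<And>x y. x \<in> C' \<Longrightarrow> y \<in> C' \<Longrightarrow> x \<noteq> y \<Longrightarrow> g x > 0 \<Longrightarrow> g y > 0 \<Longrightarrow> max (g x) (g y) < d x y"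
      and g3: "\<And>x. x \<in> C' \<Longrightarrow> g x > 0 \<Longrightarrow> t \<le> d c x \<and> g x \<le> p + 1 + d c x \<and> g x \<le> s + d c x"
      using g(1) unfolding feasible_def by (simp_all add: min_add_distrib_left)
    let ?h = "\<lambda>x. if x \<in> C then f x else g x"
    have C': "x \<notin> C" if "x \<in> C'" for x using that disj by blast
    have cross: "f x < d x y \<and> g y < d x y" if "x \<in> C" "y \<in> C'" "f x > 0" "g y > 0" for x y
      using f3[OF that(1,3)] g3[OF that(2,4)] across[OF that(1,2)] by linarith
    have "feasible d e (C \<union> C') r q p ?h"
      unfolding feasible_def
    proof (intro conjI ballI impI)
      fix x assume "x \<in> C \<union> C'"
      then show "?h x \<le> e x" using f1[of x] g1[of x] by auto
    next
      fix x y assume x: "x \<in> C \<union> C'" and y: "y \<in> C \<union> C'" and xy: "x \<noteq> y \<and> 0 < ?h x \<and> 0 < ?h y"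
      consider "x \<in> C" "y \<in> C" | "x \<in> C" "y \<in> C'" | "x \<in> C'" "y \<in> C" | "x \<in> C'" "y \<in> C'"
        using x y by blast
      then show "max (?h x) (?h y) < d x y"
      proof cases
        case 1
        then show ?thesis using f2[of x y] xy by simp
      next
        case 2
        then show ?thesis using cross[of x y] xy C'[of y] by simp
      next
        case 3
        then show ?thesis using cross[of y x] xy C'[of x] unfolding sym[of x y] by simp
      next
        case 4
        then show ?thesis using g2[of x y] xy C'[of x] C'[of y] by simp
      qed
    next
      fix x assume x: "x \<in> C \<union> C'" "0 < ?h x"
      have "q \<le> d r x \<and> ?h x \<le> p + d r x"
      proof (cases "x \<in> C")
        case True
        then show ?thesis using f3[of x] x(2) unfolding s_def by simp
      next
        case False
        then have "x \<in> C'" "0 < g x" using x by auto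
        then show ?thesis using False g3[of x] down[of x] unfolding t_def by auto
      qed
      then show "q \<le> d r x" "?h x \<le> p + d r x" by auto
    qed
    from opt_upper[OF this] have "(\<Sum>x\<in>C \<union> C'. ?h x) \<le> opt d e (C \<union> C') r q p" .
    moreover have "(\<Sum>x\<in>C \<union> C'. ?h x) = (\<Sum>x\<in>C. f x) + (\<Sum>x\<in>C'. g x)"
      using C' by (subst sum.union_disjoint[OF fin disj]) (auto intro!: sum.cong)
    ultimately show "opt d e C r (max q i) (min p (max (q - 1) j)) +
       opt d e C' c (max (q - 1) j) (min (p + 1) (max q i)) \<le> opt d e (C \<union> C') r q p"
      using f(2) g(2) unfolding s_def t_def by simp
  qed
qed

section \<open>Memory layout\<close>

text \<open>The memory holds several arrays with up to three indices below \<open>B\<close>, addressed by the digits \<open>t\<close>, \<open>i\<close>,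
\<open>j\<close>, \<open>k\<close> in base \<open>B\<close>, where \<open>t\<close> is the number of the array. Addresses with \<open>t = 0\<close> are left to the
input.\<close>

definition ad :: "nat \<Rightarrow> nat \<Rightarrow> nat \<Rightarrow> nat \<Rightarrow> nat \<Rightarrow> nat" where
  "ad B t i j k = ((t * B + i) * B + j) * B + k"

lemma digit_eq_iff:
  fixes B :: nat
  assumes "k < B" "k' < B"
  shows "x * B + k = x' * B + k' \<longleftrightarrow> x = x' \<and> k = k'"
proof
  assume eq: "x * B + k = x' * B + k'"
  have "x = (x * B + k) div B" "x' = (x' * B + k') div B" using assms by auto
  then show "x = x' \<and> k = k'" using eq by auto
qed simp

lemma ad_eq_iff [simp]:
  "i < B \<Longrightarrow> j < B \<Longrightarrow> k < B \<Longrightarrow> i' < B \<Longrightarrow> j' < B \<Longrightarrow> k' < B \<Longrightarrow>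
   ad B t i j k = ad B t' i' j' k' \<longleftrightarrow> t = t' \<and> i = i' \<and> j = j' \<and> k = k'"
  unfolding ad_def by (simp add: digit_eq_iff)

lemma ad_ge: "1 \<le> t \<Longrightarrow> B * B * B \<le> ad B t i j k"
proof -
  assume "1 \<le> t"
  then have "((1 * B + 0) * B + 0) * B + 0 \<le> ad B t i j k"
    unfolding ad_def by (intro add_mono mult_mono) auto
  then show ?thesis by simp
qed

lemma input_neq_ad:
  assumes "a < 2 * n + 10" "1 \<le> t"
  shows "a \<noteq> ad (n + 10) t i j k" "ad (n + 10) t i j k \<noteq> a"
proof -
  have "2 \<le> 10 * (10::nat)" by simp
  also have "\<dots> \<le> (n + 10) * (n + 10)" by (intro mult_mono) auto
  finally have "2 * (n + 10) \<le> (n + 10) * (n + 10) * (n + 10)"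
    by (intro mult_right_mono) auto
  moreover have "a < 2 * (n + 10)" using assms(1) by simp
  ultimately have "a < ad (n + 10) t i j k"
    using ad_ge[OF assms(2), of "n + 10" i j k] by (meson less_le_trans)
  then show "a \<noteq> ad (n + 10) t i j k" by simp
  then show "ad (n + 10) t i j k \<noteq> a" by simp
qed

section \<open>The program\<close>

text \<open>\<open>Order\<close> is the order \<open>n\<close> of the tree, \<open>Edges\<close> the number of its edges, \<open>Base\<close> the base \<open>n + 10\<close> of
addresses, \<open>Entries\<close> the number \<open>n + 1\<close> of possible values of a table index, and \<open>Merges\<close> the number
\<open>n - 1\<close> of merging steps; the others are indices.\<close>

datatype var = Order | Base | Entries | Merges | Edges | VI | VE | VU | VV | VX | VP | VK | VC | VR | VQ | VS | VT

definition cell :: "nat \<Rightarrow> var exp \<Rightarrow> var exp \<Rightarrow> var exp \<Rightarrow> var exp" where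
  "cell t i j k = Plus (Times (Plus (Times (Plus (Times (Const t) (Var Base)) i) (Var Base)) j) (Var Base)) k"

abbreviation visited :: "var exp \<Rightarrow> var exp" where "visited v \<equiv> cell 1 (Const 0) (Const 0) v"
abbreviation counter :: "var exp" where "counter \<equiv> cell 2 (Const 0) (Const 0) (Const 0)"
abbreviation child :: "var exp \<Rightarrow> var exp" where "child i \<equiv> cell 3 (Const 0) (Const 0) i"
abbreviation parent :: "var exp \<Rightarrow> var exp" where "parent i \<equiv> cell 4 (Const 0) (Const 0) i"
abbreviation distance :: "var exp \<Rightarrow> var exp \<Rightarrow> var exp" where "distance x y \<equiv> cell 5 (Const 0) x y"
abbreviation table :: "var exp \<Rightarrow> var exp \<Rightarrow> var exp \<Rightarrow> var exp" where "table v q p \<equiv> cell 6 v q p"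

definition Max2 :: "'v exp \<Rightarrow> 'v exp \<Rightarrow> 'v exp" where "Max2 a b = Plus a (Minus b a)"
definition Min2 :: "'v exp \<Rightarrow> 'v exp \<Rightarrow> 'v exp" where "Min2 a b = Minus a (Minus a b)"

lemma ev_Max2 [simp]: "ev (Max2 a b) \<sigma> M = max (ev a \<sigma> M) (ev b \<sigma> M)"
  by (simp add: Max2_def)

lemma ev_Min2 [simp]: "ev (Min2 a b) \<sigma> M = min (ev a \<sigma> M) (ev b \<sigma> M)"
  by (simp add: Min2_def)

text \<open>One step of the search along an edge from \<open>u\<close> to \<open>v\<close>. The counter runs downwards from \<open>n - 1\<close>, so that
the arrays of children and parents finally list the search in reverse order, as a growth list
does.\<close>

definition attach :: "var \<Rightarrow> var \<Rightarrow> var cmd" where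
  "attach u v =
    When (Times (Read (visited (Var u))) (Minus (Const 1) (Read (visited (Var v)))))
     (Loop VX Order
       (When (Read (visited (Var VX)))
         (Write (distance (Var v) (Var VX)) (Plus (Read (distance (Var u) (Var VX))) (Const 1)) ;;
          Write (distance (Var VX) (Var v)) (Plus (Read (distance (Var u) (Var VX))) (Const 1)))) ;;
      Write (visited (Var v)) (Const 1) ;;
      Write counter (Minus (Read counter) (Const 1)) ;;
      Write (child (Read counter)) (Var v) ;;
      Write (parent (Read counter)) (Var u))"

text \<open>Each of the \<open>n\<close> rounds scans all edges in both directions. A round that starts before all vertices
are visited visits at least one more.\<close>

definition search :: "var cmd" where
  "search =
    Loop VI Order (Loop VE Edges
      (Bind VU (Read (Plus (Const 2) (Times (Const 2) (Var VE))))
      (Bind VV (Read (Plus (Const 3) (Times (Const 2) (Var VE))))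
        (attach VU VV ;; attach VV VU))))"

text \<open>The table of a vertex \<open>v\<close> on its own has the entry \<open>min p (ecc v)\<close> for \<open>q = 0\<close>, computed as a maximum
over all distances from \<open>v\<close>; the entries for \<open>q > 0\<close> are \<open>0\<close>, as in the initial memory.\<close>

definition init_tables :: "var cmd" where
  "init_tables =
    Loop VV Order (Loop VP Entries
      (Write (table (Var VV) (Const 0) (Var VP))
        (MaxOver VX Order (Min2 (Var VP) (Read (distance (Var VV) (Var VX)))))))"

text \<open>The table of the parent is overwritten in place. An entry depends on parent entries with the same or
a larger \<open>q\<close> and the same or a smaller \<open>p\<close>; so it is safe to let \<open>q\<close> increase and \<open>p\<close> decrease.\<close>

definition merge_tables :: "var cmd" where
  "merge_tables =
    Loop VQ Entries (Loop VI Entries (Bind VP (Minus (Var Order) (Var VI))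
      (Write (table (Var VR) (Var VQ) (Var VP))
        (MaxOver VS Entries (MaxOver VT Entries
          (Plus
            (Read (table (Var VR) (Max2 (Var VQ) (Var VS))
              (Min2 (Var VP) (Max2 (Minus (Var VQ) (Const 1)) (Var VT)))))
            (Read (table (Var VC) (Max2 (Minus (Var VQ) (Const 1)) (Var VT))
              (Min2 (Plus (Var VP) (Const 1)) (Max2 (Var VQ) (Var VS)))))))))))"

definition contract :: "var cmd" where
  "contract =
    Loop VK Merges (Bind VC (Read (child (Var VK))) (Bind VR (Read (parent (Var VK))) merge_tables))"

text \<open>The result is stored in cell \<open>0\<close>, over the first word of the input.\<close>

definition main :: "var cmd" where
  "main =
    Bind Order (Read (Const 0)) (Bind Edges (Read (Const 1)) (Bind Base (Plus (Var Order) (Const 10))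
    (Bind Entries (Plus (Var Order) (Const 1)) (Bind Merges (Minus (Var Order) (Const 1))
      (Write (visited (Const 0)) (Const 1) ;;
       Write counter (Var Merges) ;;
       search ;; init_tables ;; contract ;;
       Write (Const 0) (Read (table (Const 0) (Const 0) (Var Order))))))))"

lemma ev_cell [simp]:
  "ev (cell t i j k) \<sigma> M = ad (\<sigma> Base) t (ev i \<sigma> M) (ev j \<sigma> M) (ev k \<sigma> M)"
  by (simp add: ad_def cell_def)

section \<open>Search\<close>

text \<open>The invariant of the search: \<open>ps\<close> is the part of the tree found so far, read off the arrays from the
counter on. The zeros on the diagonal of the distance array and in the tables are those of
the initial memory.\<close>

definition grown :: "nat \<Rightarrow> (nat \<times> nat) list \<Rightarrow> (nat \<times> nat) list \<Rightarrow> (nat \<Rightarrow> nat) \<Rightarrow> bool" where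
  "grown n es ps M \<longleftrightarrow>
     growth 0 ps \<and> verts 0 ps \<subseteq> {0..<n} \<and> edges ps \<subseteq> edges es \<and>
     (\<forall>j<length es. M (2 + 2 * j) = fst (es ! j) \<and> M (3 + 2 * j) = snd (es ! j)) \<and>
     (\<forall>v<n. M (ad (n + 10) 1 0 0 v) = (if v \<in> verts 0 ps then 1 else 0)) \<and>
     M (ad (n + 10) 2 0 0 0) = n - 1 - length ps \<and>
     (\<forall>i<length ps. M (ad (n + 10) 3 0 0 (n - 1 - length ps + i)) = fst (ps ! i) \<and>
                     M (ad (n + 10) 4 0 0 (n - 1 - length ps + i)) = snd (ps ! i)) \<and>
     (\<forall>x\<in>verts 0 ps. \<forall>y\<in>verts 0 ps. M (ad (n + 10) 5 0 x y) = tdist ps x y) \<and>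
     (\<forall>v<n. M (ad (n + 10) 5 0 v v) = 0) \<and>
     (\<forall>v<n. \<forall>q\<le>n. \<forall>p\<le>n. M (ad (n + 10) 6 v q p) = 0)"

text \<open>The distances of the new vertex \<open>v\<close> are derived from the row of its neighbour \<open>u\<close>. The
entries of that row for visited vertices are not touched by the loop, which only writes cells with
the index \<open>v\<close>.\<close>

lemma wp_attach:
  assumes G: "grown n es ps M"
    and \<sigma>: "\<sigma> Base = n + 10" "\<sigma> Order = n" and uv: "\<sigma> u < n" "\<sigma> v < n" and ne: "u \<noteq> VX" "v \<noteq> VX"
    and E: "{\<sigma> u, \<sigma> v} \<in> edges es" and m: "length es \<le> n" and X: "2 * n + 10 \<le> X"
  shows "wp b X (attach u v) \<sigma>
    (grown n es (if \<sigma> u \<in> verts 0 ps \<and> \<sigma> v \<notin> verts 0 ps then (\<sigma> v, \<sigma> u) # ps else ps)) M"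
proof (cases "\<sigma> u \<in> verts 0 ps \<and> \<sigma> v \<notin> verts 0 ps")
  case False
  then show ?thesis using G uv unfolding attach_def
    by (auto simp: wp_simps grown_def \<sigma>)
next
  case True
  let ?B = "n + 10" and ?u = "\<sigma> u" and ?v = "\<sigma> v" and ?W = "verts 0 ps"
  let ?l = "length ps"
  have W: "x < n" if "x \<in> ?W" for x using G that unfolding grown_def by auto
  have g: "growth 0 ps" using G unfolding grown_def by simp
  have "card (insert ?v ?W) \<le> card {0..<n}"
    using W uv by (intro card_mono) auto
  then have l: "?l + 1 < n" using card_verts[OF g] True by simp
  \<comment> \<open>The cells outside row and column \<open>v\<close> of the distance array are unchanged.\<close>
  define D where "D M' \<longleftrightarrow> (\<forall>a. (\<forall>x\<in>?W. a \<noteq> ad ?B 5 0 ?v x \<and> a \<noteq> ad ?B 5 0 x ?v) \<longrightarrow> M' a = M a)" for M'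
  define I where "I i M' \<longleftrightarrow> D M' \<and>
    (\<forall>x\<in>?W. x < i \<longrightarrow> M' (ad ?B 5 0 ?v x) = Suc (tdist ps ?u x) \<and> M' (ad ?B 5 0 x ?v) = Suc (tdist ps ?u x))"
    for i M'
  have Dkeep: "M' (ad ?B t i j k) = M (ad ?B t i j k)"
    if "D M'" "i < ?B" "j < ?B" "k < ?B" "t \<noteq> 5 \<or> (j \<noteq> ?v \<and> k \<noteq> ?v)" for M' t i j k
  proof -
    have "ad ?B t i j k \<noteq> ad ?B 5 0 ?v x \<and> ad ?B t i j k \<noteq> ad ?B 5 0 x ?v" if "x \<in> ?W" for x
      using that \<open>i < ?B\<close> \<open>j < ?B\<close> \<open>k < ?B\<close> \<open>t \<noteq> 5 \<or> _\<close> W[OF that] uv by auto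
    then show ?thesis using \<open>D M'\<close> unfolding D_def by blast
  qed
  have diag: "M' (ad ?B 5 0 w w) = 0" if "D M'" "w < n" for M' w
  proof -
    have "ad ?B 5 0 w w \<noteq> ad ?B 5 0 ?v x \<and> ad ?B 5 0 w w \<noteq> ad ?B 5 0 x ?v" if "x \<in> ?W" for x
      using that \<open>w < n\<close> W[OF that] uv True by auto
    then show ?thesis using \<open>D M'\<close> \<open>w < n\<close> G unfolding D_def grown_def by simp
  qed
  have Din: "M' a = M a" if "D M'" "a < 2 * n + 10" for M' a
    using that(1) input_neq_ad(1)[OF that(2), of 5] unfolding D_def by simp
  have vis: "M (ad ?B 1 0 0 x) = (if x \<in> ?W then 1 else 0)" if "x < n" for x
    using G that unfolding grown_def by blast
  have td: "M (ad ?B 5 0 x y) = tdist ps x y" if "x \<in> ?W" "y \<in> ?W" for x y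
    using G that unfolding grown_def by blast
  have td_le: "Suc (tdist ps x y) \<le> X" for x y
    using tdist_le_length[of ps x y] l X by simp
  let ?body = "When (Read (visited (Var VX)))
         (Write (distance (Var v) (Var VX)) (Plus (Read (distance (Var u) (Var VX))) (Const 1)) ;;
          Write (distance (Var VX) (Var v)) (Plus (Read (distance (Var u) (Var VX))) (Const 1)))"
  have loop: "wp b X (Loop VX Order ?body) \<sigma> (I n) M"
  proof (rule wp_loop[where I = I])
    show "I 0 M" unfolding I_def D_def by simp
  next
    fix i M' assume i: "i < \<sigma> Order" and I: "I i M'"
    then have D: "D M'" unfolding I_def by simp
    have v1: "M' (ad ?B 1 0 0 i) = (if i \<in> ?W then 1 else 0)"
      using Dkeep[OF D, of 0 0 i 1] vis[of i] i \<sigma> by simp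
    show "wp b X ?body (\<sigma>(VX := i)) (I (Suc i)) M'"
    proof (cases "i \<in> ?W")
      case False
      then have "I (Suc i) M'" using I unfolding I_def by (auto simp: less_Suc_eq)
      then show ?thesis using v1 False by (simp add: wp_simps \<sigma>)
    next
      case True
      let ?s = "Suc (tdist ps ?u i)"
      have iv: "i \<noteq> ?v" and uv': "?u \<noteq> ?v" using True \<open>?u \<in> ?W \<and> ?v \<notin> ?W\<close> by auto
      have d: "M' (ad ?B 5 0 ?u i) = tdist ps ?u i"
        using Dkeep[OF D, of 0 ?u i 5] td[of ?u i] True \<open>?u \<in> ?W \<and> ?v \<notin> ?W\<close> iv uv' uv i \<sigma> by simp
      let ?M = "M'(ad ?B 5 0 ?v i := ?s, ad ?B 5 0 i ?v := ?s)"
      have "D ?M" using D True unfolding D_def by auto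
      moreover have "?M (ad ?B 5 0 ?v x) = Suc (tdist ps ?u x) \<and> ?M (ad ?B 5 0 x ?v) = Suc (tdist ps ?u x)"
        if "x \<in> ?W" "x < Suc i" for x
      proof -
        have "x < n" "x \<noteq> ?v" using W that True \<open>?u \<in> ?W \<and> ?v \<notin> ?W\<close> by auto
        then show ?thesis using I that iv uv i \<sigma> unfolding I_def by (auto simp: less_Suc_eq)
      qed
      ultimately have "I (Suc i) ?M" unfolding I_def by blast
      then show ?thesis using v1 True d ne uv uv' i td_le by (simp add: wp_simps \<sigma>)
    qed
  qed (simp add: \<sigma>)
  have final: "wp b X (Write (visited (Var v)) (Const 1) ;;
      Write counter (Minus (Read counter) (Const 1)) ;;
      Write (child (Read counter)) (Var v) ;;
      Write (parent (Read counter)) (Var u)) \<sigma> (grown n es ((?v, ?u) # ps)) M'"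
    if I: "I n M'" for M'
  proof -
    have D: "D M'" using I unfolding I_def by simp
    let ?c = "n - 1 - ?l - 1"
    have cnt: "M' (ad ?B 2 0 0 0) = n - 1 - ?l"
      using Dkeep[OF D, of 0 0 0 2] G unfolding grown_def by simp
    let ?M = "M'(ad ?B 1 0 0 ?v := 1, ad ?B 2 0 0 0 := ?c, ad ?B 3 0 0 ?c := ?v, ad ?B 4 0 0 ?c := ?u)"
    have "grown n es ((?v, ?u) # ps) ?M" unfolding grown_def
    proof (intro conjI allI ballI impI)
      show "growth 0 ((?v, ?u) # ps)" using g True by simp
      show "verts 0 ((?v, ?u) # ps) \<subseteq> {0..<n}" using W uv by auto
      show "edges ((?v, ?u) # ps) \<subseteq> edges es" using E G unfolding grown_def by (simp add: insert_commute)
    next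
      fix j assume j: "j < length es"
      then have j': "2 + 2 * j < 2 * n + 10" "3 + 2 * j < 2 * n + 10" using m by auto
      show "?M (2 + 2 * j) = fst (es ! j)"
        using Din[OF D j'(1)] G j j'(1) unfolding grown_def by (simp add: input_neq_ad)
      show "?M (3 + 2 * j) = snd (es ! j)"
        using Din[OF D j'(2)] G j j'(2) unfolding grown_def by (simp add: input_neq_ad)
    next
      fix w assume w: "w < n"
      show "?M (ad ?B 1 0 0 w) = (if w \<in> verts 0 ((?v, ?u) # ps) then 1 else 0)"
        using Dkeep[OF D, of 0 0 w 1] vis[OF w] w uv l by simp
    next
      show "?M (ad ?B 2 0 0 0) = n - 1 - length ((?v, ?u) # ps)" using l by simp
    next
      fix i assume i: "i < length ((?v, ?u) # ps)"
      have "?M (ad ?B 3 0 0 (?c + i)) = fst (((?v, ?u) # ps) ! i) \<and>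
        ?M (ad ?B 4 0 0 (?c + i)) = snd (((?v, ?u) # ps) ! i)"
      proof (cases i)
        case 0
        then show ?thesis using l by simp
      next
        case (Suc k)
        then have k: "k < ?l" "?c + i = n - 1 - ?l + k" using i l by auto
        have "M (ad ?B 3 0 0 (?c + i)) = fst (ps ! k) \<and> M (ad ?B 4 0 0 (?c + i)) = snd (ps ! k)"
          using G k unfolding grown_def by auto
        \<comment> \<open>A name for the index keeps the simplifier from normalizing the address.\<close>
        moreover obtain a where a: "a = ?c + i" by simp
        moreover have "a < ?B" "a \<noteq> ?c" using a Suc k(1) l by auto
        ultimately show ?thesis using Suc l uv Dkeep[OF D, of 0 0 a 3] Dkeep[OF D, of 0 0 a 4]
          unfolding a[symmetric] by simp
      qed
      then show "?M (ad ?B 3 0 0 (n - 1 - length ((?v, ?u) # ps) + i)) = fst (((?v, ?u) # ps) ! i)"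
        "?M (ad ?B 4 0 0 (n - 1 - length ((?v, ?u) # ps) + i)) = snd (((?v, ?u) # ps) ! i)"
        by simp_all
    next
      fix x y assume x: "x \<in> verts 0 ((?v, ?u) # ps)" and y: "y \<in> verts 0 ((?v, ?u) # ps)"
      have xn: "x < n" "y < n" using x y W uv by auto
      have vv: "M' (ad ?B 5 0 ?v ?v) = 0"
        using diag[OF D, of ?v] uv by simp
      have "M' (ad ?B 5 0 x y) = tdist ((?v, ?u) # ps) x y"
        using x y vv I Dkeep[OF D, of 0 x y 5] td W xn tdist_sym[of ps x ?u] True unfolding I_def by auto
      then show "?M (ad ?B 5 0 x y) = tdist ((?v, ?u) # ps) x y" using xn uv l by simp
    next
      fix w assume "w < n"
      then show "?M (ad ?B 5 0 w w) = 0" using diag[OF D, of w] uv l by simp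
    next
      fix w q p assume "w < n" "q \<le> n" "p \<le> n"
      then show "?M (ad ?B 6 w q p) = 0"
        using Dkeep[OF D, of w q p 6] G uv l unfolding grown_def by simp
    qed
    then show ?thesis using cnt uv l X by (simp add: wp_simps \<sigma>)
  qed
  have "M (ad ?B 1 0 0 ?u) * (1 - M (ad ?B 1 0 0 ?v)) = 1" using vis uv True by simp
  then have cond: "ev (Times (Read (visited (Var u))) (Minus (Const 1) (Read (visited (Var v))))) \<sigma> M > 0"
    by (simp add: \<sigma>)
  show ?thesis unfolding attach_def
    by (subst wp_simps(3), subst if_P[OF cond], subst if_P[OF True], subst wp_simps(2))
      (rule wp_mono[OF loop final])
qed

lemma grownD:
  assumes "grown n es ps M"
  shows "growth 0 ps" "verts 0 ps \<subseteq> {0..<n}" "card (verts 0 ps) = Suc (length ps)"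
  using assms card_verts[of 0 ps] by (simp_all add: grown_def)

text \<open>After \<open>i\<close> rounds at least \<open>min i (n - 1)\<close> vertices besides the root have been found. If a round found
none, then no edge of the graph would leave the visited set, which contradicts connectivity unless
this set contains all vertices.\<close>

lemma wp_search:
  assumes G: "grown n es [] M"
    and \<sigma>: "\<sigma> Base = n + 10" "\<sigma> Order = n" "\<sigma> Edges = length es"
    and conn: "connected_graph {0..<n} (edges es)"
    and es: "\<And>u v. (u, v) \<in> set es \<Longrightarrow> u < n \<and> v < n"
    and m: "length es \<le> n" and n: "0 < n" and X: "2 * n + 10 \<le> X" and b: "n \<le> b"
    and Q: "\<And>M ps. grown n es ps M \<Longrightarrow> verts 0 ps = {0..<n} \<Longrightarrow> Q M"
  shows "wp b X search \<sigma> Q M"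
proof -
  have len: "length ps \<le> n - 1" if "grown n es ps M" for ps M
  proof -
    have "card (verts 0 ps) \<le> card {0..<n}"
      using grownD(2)[OF that] by (intro card_mono) auto
    then show ?thesis using grownD(3)[OF that] by simp
  qed
  \<comment> \<open>Edge number \<open>j\<close> does not leave the set of visited vertices.\<close>
  define quiet where "quiet j ps \<longleftrightarrow> (fst (es ! j) \<in> verts 0 ps \<longleftrightarrow> snd (es ! j) \<in> verts 0 ps)"
    for j and ps :: "(nat \<times> nat) list"
  define I where "I i M \<longleftrightarrow> (\<exists>ps. grown n es ps M \<and> min i (n - 1) \<le> length ps)" for i M
  \<comment> \<open>If the current round has found no vertex yet, then none of the edges scanned so far was of use.\<close>
  define J where "J i e M \<longleftrightarrow> (\<exists>ps. grown n es ps M \<and> min i (n - 1) \<le> length ps \<and>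
    (length ps = min i (n - 1) \<longrightarrow> (\<forall>j<e. quiet j ps)))" for i e M
  show ?thesis unfolding search_def
  proof (rule wp_loop[where I = I])
    show "I 0 M" unfolding I_def using G by auto
  next
    fix M assume "I (\<sigma> Order) M"
    then obtain ps where ps: "grown n es ps M" "n - 1 \<le> length ps"
      unfolding I_def by (auto simp: \<sigma>)
    have "verts 0 ps = {0..<n}"
    proof (rule card_subset_eq)
      show "verts 0 ps \<subseteq> {0..<n}" by (rule grownD(2)[OF ps(1)])
      show "card (verts 0 ps) = card {0..<n}"
        using ps(2) len[OF ps(1)] n grownD(3)[OF ps(1)] by simp
    qed simp
    then show "Q M" using Q ps by blast
  next
    fix i M assume i: "i < \<sigma> Order" and Ii: "I i M"
    show "wp b X (Loop VE Edges
      (Bind VU (Read (Plus (Const 2) (Times (Const 2) (Var VE))))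
      (Bind VV (Read (Plus (Const 3) (Times (Const 2) (Var VE))))
        (attach VU VV ;; attach VV VU)))) (\<sigma>(VI := i)) (I (Suc i)) M"
    proof (rule wp_loop[where I = "J i"])
      show "J i 0 M" using Ii unfolding I_def J_def by simp
    next
      fix M assume "J i ((\<sigma>(VI := i)) Edges) M"
      then obtain ps where ps: "grown n es ps M" "min i (n - 1) \<le> length ps"
        "length ps = min i (n - 1) \<longrightarrow> (\<forall>j<length es. quiet j ps)"
        unfolding J_def by (auto simp: \<sigma>)
      have "min (Suc i) (n - 1) \<le> length ps"
      proof (rule ccontr)
        assume "\<not> min (Suc i) (n - 1) \<le> length ps"
        then have l: "length ps = min i (n - 1)" "length ps < n - 1" using ps(2) by linarith+
        have "verts 0 ps \<noteq> {0..<n}"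
        proof
          assume "verts 0 ps = {0..<n}"
          then have "card (verts 0 ps) = n" by simp
          then show False using l(2) grownD(3)[OF ps(1)] by linarith
        qed
        then have "verts 0 ps \<subset> {0..<n}" using grownD(2)[OF ps(1)] by blast
        then obtain u v where uv: "u \<in> verts 0 ps" "v \<notin> verts 0 ps" "{u, v} \<in> edges es"
          using crossing_edge[OF conn] root_in_verts[of 0 ps] by blast
        then obtain e where e: "e \<in> set es" "{u, v} = {fst e, snd e}"
          unfolding edges_def by (auto simp: case_prod_unfold)
        then obtain j where j: "j < length es" "es ! j = e" unfolding in_set_conv_nth by blast
        then have "quiet j ps" using ps(3) l by simp
        then show False using e uv j unfolding quiet_def by (auto simp: doubleton_eq_iff)
      qed
      then show "I (Suc i) M" unfolding I_def using ps by blast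
    next
      fix e M assume e: "e < (\<sigma>(VI := i)) Edges" and "J i e M"
      then obtain ps where ps: "grown n es ps M" "min i (n - 1) \<le> length ps"
        "length ps = min i (n - 1) \<longrightarrow> (\<forall>j<e. quiet j ps)"
        unfolding J_def by auto
      have e: "e < length es" using e by (simp add: \<sigma>)
      obtain u v where uv: "es ! e = (u, v)" by fastforce
      then have uvs: "(u, v) \<in> set es" using e nth_mem by metis
      then have uvn: "u < n" "v < n" using es by auto
      have Eu: "{u, v} \<in> edges es" unfolding edges_def
        by (rule image_eqI[of _ _ "(u, v)"]) (use uvs in auto)
      then have Ev: "{v, u} \<in> edges es" by (simp add: insert_commute)
      have mem: "M (2 + 2 * e) = u" "M (3 + 2 * e) = v"
        using ps(1) e uv unfolding grown_def by auto
      let ?\<sigma> = "\<sigma>(VI := i, VE := e, VU := u, VV := v)"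
      define ps1 where "ps1 = (if u \<in> verts 0 ps \<and> v \<notin> verts 0 ps then (v, u) # ps else ps)"
      define ps2 where "ps2 = (if v \<in> verts 0 ps1 \<and> u \<notin> verts 0 ps1 then (u, v) # ps1 else ps1)"
      have J: "J i (Suc e) M'" if "grown n es ps2 M'" for M'
      proof -
        consider "ps2 = ps" "quiet e ps" | "length ps2 > length ps"
          unfolding ps2_def ps1_def quiet_def using uv
          by (cases "u \<in> verts 0 ps"; cases "v \<in> verts 0 ps") auto
        then have "min i (n - 1) \<le> length ps2 \<and> (length ps2 = min i (n - 1) \<longrightarrow> (\<forall>j<Suc e. quiet j ps2))"
        proof cases
          case 1
          then show ?thesis using ps(2,3) by (auto simp: less_Suc_eq)
        next
          case 2
          then show ?thesis using ps(2) by linarith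
        qed
        then show ?thesis unfolding J_def using that by blast
      qed
      have 1: "wp b X (attach VU VV) ?\<sigma> (grown n es ps1) M"
        using wp_attach[OF ps(1), of ?\<sigma> VU VV X b] Eu uvn m X by (simp add: \<sigma> ps1_def cong: if_cong)
      have 2: "wp b X (attach VV VU) ?\<sigma> (J i (Suc e)) M'" if "grown n es ps1 M'" for M'
        by (rule wp_mono[OF _ J], unfold ps2_def)
          (use wp_attach[OF that, of ?\<sigma> VV VU X b] Ev uvn m X in \<open>simp add: \<sigma> cong: if_cong\<close>)
      have "wp b X (attach VU VV ;; attach VV VU) ?\<sigma> (J i (Suc e)) M"
        by (subst wp_simps(2)) (rule wp_mono[OF 1 2])
      then show "wp b X (Bind VU (Read (Plus (Const 2) (Times (Const 2) (Var VE))))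
        (Bind VV (Read (Plus (Const 3) (Times (Const 2) (Var VE))))
        (attach VU VV ;; attach VV VU))) (\<sigma>(VI := i, VE := e)) (J i (Suc e)) M"
        using mem uvn b by (simp add: wp_simps(4))
    qed
  qed
qed

section \<open>Tables\<close>

lemma wp_init_tables:
  assumes \<sigma>: "\<sigma> Base = n + 10" "\<sigma> Order = n" "\<sigma> Entries = n + 1" and X: "n \<le> X"
    and D: "\<And>v x. v < n \<Longrightarrow> x < n \<Longrightarrow> M (ad (n + 10) 5 0 v x) = d v x"
    and Q: "\<And>M'. (\<And>v p. v < n \<Longrightarrow> p \<le> n \<Longrightarrow>
        M' (ad (n + 10) 6 v 0 p) = mx (\<lambda>x. min p (d v x)) n) \<Longrightarrow>
      (\<And>a. (\<And>v p. v < n \<Longrightarrow> p \<le> n \<Longrightarrow> a \<noteq> ad (n + 10) 6 v 0 p) \<Longrightarrow> M' a = M a) \<Longrightarrow> Q M'"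
  shows "wp b X init_tables \<sigma> Q M"
proof -
  let ?B = "n + 10"
  let ?g = "\<lambda>v p. mx (\<lambda>x. min p (d v x)) n"
  define K where "K i j M' \<longleftrightarrow>
    (\<forall>v<n. \<forall>p\<le>n. v < i \<or> (v = i \<and> p < j) \<longrightarrow> M' (ad ?B 6 v 0 p) = ?g v p) \<and>
    (\<forall>a. (\<forall>v<n. \<forall>p\<le>n. a \<noteq> ad ?B 6 v 0 p) \<longrightarrow> M' a = M a)" for i j M'
  show ?thesis unfolding init_tables_def
  proof (rule wp_loop[where I = "\<lambda>i. K i 0"])
    show "K 0 0 M" unfolding K_def by simp
  next
    fix M' assume "K (\<sigma> Order) 0 M'"
    then show "Q M'" using Q[of M'] unfolding K_def by (simp add: \<sigma>)
  next
    fix i M' assume i: "i < \<sigma> Order" and K: "K i 0 M'"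
    show "wp b X (Loop VP Entries
      (Write (table (Var VV) (Const 0) (Var VP))
        (MaxOver VX Order (Min2 (Var VP) (Read (distance (Var VV) (Var VX)))))))
      (\<sigma>(VV := i)) (K (Suc i) 0) M'"
    proof (rule wp_loop[where I = "K i"])
      show "K i 0 M'" by (rule K)
    next
      fix M' assume "K i ((\<sigma>(VV := i)) Entries) M'"
      then have "K i (n + 1) M'" by (simp add: \<sigma>)
      then have "M' (ad ?B 6 v 0 p) = ?g v p" if "v < n" "p \<le> n" "v < Suc i" for v p
        using that unfolding K_def by (cases "v = i") auto
      then show "K (Suc i) 0 M'" using \<open>K i (n + 1) M'\<close> unfolding K_def by auto
    next
      fix j M' assume j: "j < (\<sigma>(VV := i)) Entries" and K: "K i j M'"
      have i: "i < n" and j: "j \<le> n" using i j by (simp_all add: \<sigma>)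
      have "M' (ad ?B 5 0 i x) = d i x" if "x < n" for x
      proof -
        have "M' (ad ?B 5 0 i x) = M (ad ?B 5 0 i x)"
          using K that i unfolding K_def by simp
        then show ?thesis using D i that by simp
      qed
      then have val: "mx (\<lambda>x. min j (M' (ad ?B 5 0 i x))) n = ?g i j" by (intro mx_cong) simp
      have "?g i j \<le> X" using j X by (intro mx_least) (simp add: min.coboundedI1)
      moreover have "K i (Suc j) (M'(ad ?B 6 i 0 j := ?g i j))"
        using K i j unfolding K_def by (auto simp: less_Suc_eq)
      ultimately show "wp b X (Write (table (Var VV) (Const 0) (Var VP))
        (MaxOver VX Order (Min2 (Var VP) (Read (distance (Var VV) (Var VX))))))
        (\<sigma>(VV := i, VP := j)) (K i (Suc j)) M'"
        using val by (simp add: wp_simps \<sigma>)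
    qed
  qed
qed

text \<open>When the entry \<open>(q, p)\<close> is computed, the new entries are those \<open>(s, p')\<close> with \<open>s < q\<close>, or with \<open>s = q\<close> and
\<open>p' > p\<close>; the recurrence reads none of them.\<close>

lemma wp_merge_tables:
  assumes \<sigma>: "\<sigma> Base = n + 10" "\<sigma> Order = n" "\<sigma> Entries = n + 1" "\<sigma> VR = r" "\<sigma> VC = c"
    and rc: "r < n" "c < n" "r \<noteq> c" and b: "n \<le> b"
    and A: "\<And>q p. q \<le> n \<Longrightarrow> p \<le> n \<Longrightarrow> M (ad (n + 10) 6 r q p) = A q p"
    and A': "\<And>q p. q \<le> n \<Longrightarrow> p \<le> n \<Longrightarrow> M (ad (n + 10) 6 c q p) = A' q p"
    and X: "\<And>q p. q \<le> n \<Longrightarrow> p \<le> n \<Longrightarrow> merge n A A' q p \<le> X"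
    and Q: "\<And>M'. (\<And>q p. q \<le> n \<Longrightarrow> p \<le> n \<Longrightarrow> M' (ad (n + 10) 6 r q p) = merge n A A' q p) \<Longrightarrow>
      (\<And>a. (\<And>q p. q \<le> n \<Longrightarrow> p \<le> n \<Longrightarrow> a \<noteq> ad (n + 10) 6 r q p) \<Longrightarrow> M' a = M a) \<Longrightarrow> Q M'"
  shows "wp b X merge_tables \<sigma> Q M"
proof -
  let ?B = "n + 10"
  \<comment> \<open>Column \<open>p = n - i\<close> is next; the new columns, \<open>p > n - i\<close>, are written \<open>n < p + i\<close>, which stays correct for \<open>i = n + 1\<close>, where the subtraction is truncated.\<close>
  define K where "K q i M' \<longleftrightarrow>
    (\<forall>s\<le>n. \<forall>p\<le>n. M' (ad ?B 6 r s p) = (if s < q \<or> (s = q \<and> n < p + i) then merge n A A' s p else A s p)) \<and>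
    (\<forall>a. (\<forall>s\<le>n. \<forall>p\<le>n. a \<noteq> ad ?B 6 r s p) \<longrightarrow> M' a = M a)" for q i M'
  show ?thesis unfolding merge_tables_def
  proof (rule wp_loop[where I = "\<lambda>q. K q 0"])
    show "K 0 0 M" unfolding K_def using A by simp
  next
    fix M' assume "K (\<sigma> Entries) 0 M'"
    then show "Q M'" using Q[of M'] unfolding K_def by (simp add: \<sigma>)
  next
    fix q M' assume q: "q < \<sigma> Entries" and K: "K q 0 M'"
    show "wp b X (Loop VI Entries (Bind VP (Minus (Var Order) (Var VI))
      (Write (table (Var VR) (Var VQ) (Var VP))
        (MaxOver VS Entries (MaxOver VT Entries
          (Plus
            (Read (table (Var VR) (Max2 (Var VQ) (Var VS))
              (Min2 (Var VP) (Max2 (Minus (Var VQ) (Const 1)) (Var VT)))))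
            (Read (table (Var VC) (Max2 (Minus (Var VQ) (Const 1)) (Var VT))
              (Min2 (Plus (Var VP) (Const 1)) (Max2 (Var VQ) (Var VS)))))))))))
      (\<sigma>(VQ := q)) (K (Suc q) 0) M'"
    proof (rule wp_loop[where I = "K q"])
      show "K q 0 M'" by (rule K)
    next
      fix M' assume K: "K q ((\<sigma>(VQ := q)) Entries) M'"
      then show "K (Suc q) 0 M'" unfolding K_def by (auto simp: \<sigma> less_Suc_eq)
    next
      fix i M' assume i: "i < (\<sigma>(VQ := q)) Entries" and K: "K q i M'"
      have q: "q \<le> n" and i: "i \<le> n" using i q by (simp_all add: \<sigma>)
      let ?p = "n - i"
      have old: "M' (ad ?B 6 r (max q s) (min ?p t)) = A (max q s) (min ?p t)" if "s \<le> n" for s t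
      proof -
        have "\<not> (max q s < q \<or> (max q s = q \<and> n < min ?p t + i))" "max q s \<le> n" "min ?p t \<le> n"
          using that q i by auto
        note * = this
        have "M' (ad ?B 6 r (max q s) (min ?p t)) =
          (if max q s < q \<or> (max q s = q \<and> n < min ?p t + i) then merge n A A' (max q s) (min ?p t)
           else A (max q s) (min ?p t))"
          using K *(2,3) unfolding K_def by blast
        then show ?thesis unfolding if_not_P[OF *(1)] .
      qed
      have other: "M' (ad ?B 6 c s t) = A' s t" if "s \<le> n" "t \<le> n" for s t
      proof -
        have "M' (ad ?B 6 c s t) = M (ad ?B 6 c s t)"
          using K that rc unfolding K_def by simp
        then show ?thesis using A' that by simp
      qed
      have val: "mx (\<lambda>s. mx (\<lambda>t. M' (ad ?B 6 r (max q s) (min ?p (max (q - 1) t))) +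
          M' (ad ?B 6 c (max (q - 1) t) (min (?p + 1) (max q s)))) (n + 1)) (n + 1) = merge n A A' q ?p"
        unfolding merge_def
      proof (intro mx_cong)
        fix s t assume st: "s < n + 1" "t < n + 1"
        then have "max (q - 1) t \<le> n" "min (?p + 1) (max q s) \<le> n" using q by auto
        with st show "M' (ad ?B 6 r (max q s) (min ?p (max (q - 1) t))) +
          M' (ad ?B 6 c (max (q - 1) t) (min (?p + 1) (max q s))) =
          A (max q s) (min ?p (max (q - 1) t)) + A' (max (q - 1) t) (min (?p + 1) (max q s))"
          using old[of s "max (q - 1) t"] other[of "max (q - 1) t" "min (?p + 1) (max q s)"] by simp
      qed
      have "K q (Suc i) (M'(ad ?B 6 r q ?p := merge n A A' q ?p))"
        unfolding K_def
      proof (intro conjI allI impI)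
        fix s p assume sp: "s \<le> n" "p \<le> n"
        have "n < p + Suc i \<longleftrightarrow> n < p + i \<or> p = ?p" using i by auto
        then show "(M'(ad ?B 6 r q ?p := merge n A A' q ?p)) (ad ?B 6 r s p) =
          (if s < q \<or> (s = q \<and> n < p + Suc i) then merge n A A' s p else A s p)"
          using K sp q rc unfolding K_def by auto
      next
        fix a assume "\<forall>s\<le>n. \<forall>p\<le>n. a \<noteq> ad ?B 6 r s p"
        then show "(M'(ad ?B 6 r q ?p := merge n A A' q ?p)) a = M a"
          using K q unfolding K_def by simp
      qed
      then show "wp b X (Bind VP (Minus (Var Order) (Var VI))
      (Write (table (Var VR) (Var VQ) (Var VP))
        (MaxOver VS Entries (MaxOver VT Entries
          (Plus
            (Read (table (Var VR) (Max2 (Var VQ) (Var VS))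
              (Min2 (Var VP) (Max2 (Minus (Var VQ) (Const 1)) (Var VT)))))
            (Read (table (Var VC) (Max2 (Minus (Var VQ) (Const 1)) (Var VT))
              (Min2 (Plus (Var VP) (Const 1)) (Max2 (Var VQ) (Var VS))))))))))
        (\<sigma>(VQ := q, VI := i)) (K q (Suc i)) M'"
        using val X[OF q, of ?p] b by (simp add: wp_simps \<sigma> del: mx.simps)
    qed
  qed
qed

section \<open>Contraction\<close>

text \<open>The tree is contracted from its leaves: each remaining vertex \<open>v \<in> W\<close> stands for the cluster \<open>C v\<close> of
the vertices that have been contracted into it. Any path between two clusters passes through
their representatives.\<close>

definition clusters :: "nat \<Rightarrow> (nat \<Rightarrow> nat \<Rightarrow> nat) \<Rightarrow> nat set \<Rightarrow> (nat \<Rightarrow> nat set) \<Rightarrow> bool" where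
  "clusters n d W C \<longleftrightarrow>
     (\<forall>v\<in>W. v \<in> C v) \<and> (\<Union>v\<in>W. C v) = {0..<n} \<and>
     (\<forall>v\<in>W. \<forall>w\<in>W. v \<noteq> w \<longrightarrow> C v \<inter> C w = {} \<and>
        (\<forall>x\<in>C v. \<forall>y\<in>C w. d x y = d x v + d v w + d w y))"

text \<open>A leaf \<open>c\<close> of the remaining tree with neighbour \<open>r\<close> is contracted into \<open>r\<close>. Paths that leave \<open>C c\<close> pass
through \<open>c\<close> and then through \<open>r\<close>, so \<open>r\<close> can represent the union of the two clusters.\<close>

lemma clusters_leaf:
  assumes C: "clusters n d (insert c W) C" and c: "c \<notin> W" and r: "r \<in> W"
    and sym: "\<And>x y. d x y = d y x" and refl: "\<And>x. d x x = 0"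
    and leaf: "\<And>w. w \<in> W \<Longrightarrow> d c w = d r w + 1"
    and dn: "\<And>x y. d x y \<le> n" and e: "\<And>x. e x \<le> n"
  shows "clusters n d W (C(r := C r \<union> C c))"
    and "opt d e (C r \<union> C c) r q p = merge n (opt d e (C r) r) (opt d e (C c) c) q p"
proof -
  note mem = C[unfolded clusters_def, THEN conjunct1, rule_format]
  note un = C[unfolded clusters_def, THEN conjunct2, THEN conjunct1]
  note sep = C[unfolded clusters_def, THEN conjunct2, THEN conjunct2, rule_format]
  have dis: "C v \<inter> C w = {}" if "v \<in> insert c W" "w \<in> insert c W" "v \<noteq> w" for v w
    using sep[OF that] by (rule conjunct1)
  have far: "d x y = d x v + d v w + d w y"
    if "v \<in> insert c W" "w \<in> insert c W" "v \<noteq> w" "x \<in> C v" "y \<in> C w" for v w x y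
    using sep[OF that(1-3)] that(4,5) by simp
  have rc: "r \<noteq> c" using c r by blast
  have cr: "d c r = 1" using leaf[OF r] refl by simp
  have down: "d r y = d c y + 1" if "y \<in> C c" for y
  proof -
    have "d r y = d r r + d r c + d c y" using far[of r c r y] mem[of r] that rc r by blast
    then show ?thesis using cr refl[of r] sym[of r c] by linarith
  qed
  have via': "d x y = d x r + d r w + d w y" if "x \<in> C c" "w \<in> W" "w \<noteq> r" "y \<in> C w" for x y w
  proof -
    have "c \<noteq> w" using that c by blast
    then have "d x y = d x c + d c w + d w y" using far[of c w x y] that by blast
    then show ?thesis using leaf[OF that(2)] down[OF that(1)] sym[of r x] sym[of c x] by linarith
  qed
  show "clusters n d W (C(r := C r \<union> C c))" unfolding clusters_def
  proof (intro conjI ballI impI)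
    fix v assume "v \<in> W" then show "v \<in> (C(r := C r \<union> C c)) v" using mem by auto
  next
    show "(\<Union>v\<in>W. (C(r := C r \<union> C c)) v) = {0..<n}"
      unfolding un[symmetric] using r c by (auto split: if_splits)
  next
    fix v w assume vw: "v \<in> W" "w \<in> W" "v \<noteq> w"
    have "v \<noteq> c" "w \<noteq> c" using vw c by auto
    then show "(C(r := C r \<union> C c)) v \<inter> (C(r := C r \<union> C c)) w = {}"
      using dis[of v w] dis[of v c] dis[of c w] dis[of r w] dis[of v r] vw r by auto
  next
    fix v w x y assume vw: "v \<in> W" "w \<in> W" "v \<noteq> w"
      and x: "x \<in> (C(r := C r \<union> C c)) v" and y: "y \<in> (C(r := C r \<union> C c)) w"
    consider "x \<in> C v" "y \<in> C w" | "v = r" "w \<noteq> r" "x \<in> C c" "y \<in> C w" | "w = r" "v \<noteq> r" "y \<in> C c" "x \<in> C v"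
      using x y vw by (auto split: if_splits)
    then show "d x y = d x v + d v w + d w y"
    proof cases
      case 1
      then show ?thesis using far vw by blast
    next
      case 2
      then show ?thesis using via'[of x w y] vw by simp
    next
      case 3
      have "d y x = d y r + d r v + d v x" using via'[of y v x] vw 3 by simp
      then show ?thesis using sym[of x y] sym[of y r] sym[of r v] sym[of v x] unfolding 3(1) by linarith
    qed
  qed
  have fin: "finite (C v)" if "v \<in> insert c W" for v
    using un that by (intro finite_subset[OF _ finite_atLeastLessThan[of 0 n]]) blast
  show "opt d e (C r \<union> C c) r q p = merge n (opt d e (C r) r) (opt d e (C c) c) q p"
  proof (rule opt_merge)
    show "d x y = d r x + 1 + d c y" if "x \<in> C r" "y \<in> C c" for x y
    proof -
      have "d x y = d x r + d r c + d c y" using far[of r c x y] that r rc by blast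
      then show ?thesis using cr sym[of r c] sym[of x r] by linarith
    qed
    show "C r \<inter> C c = {}" using dis[of r c] r rc by blast
    show "d x y = d y x" for x y by (rule sym)
  qed (use fin r down dn e in auto)
qed

text \<open>The growth list of the tree that remains after \<open>k\<close> contractions is \<open>drop k ps\<close>, because its head is the
leaf that was added last.\<close>

definition contracted ::
  "nat \<Rightarrow> (nat \<times> nat) list \<Rightarrow> (nat \<Rightarrow> nat) \<Rightarrow> nat \<Rightarrow> (nat \<Rightarrow> nat) \<Rightarrow> bool" where
  "contracted n ps e k M \<longleftrightarrow>
     (\<forall>i<length ps. M (ad (n + 10) 3 0 0 i) = fst (ps ! i) \<and> M (ad (n + 10) 4 0 0 i) = snd (ps ! i)) \<and>
     (\<exists>C. clusters n (tdist ps) (verts 0 (drop k ps)) C \<and>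
       (\<forall>v\<in>verts 0 (drop k ps). \<forall>q\<le>n. \<forall>p\<le>n.
          M (ad (n + 10) 6 v q p) = opt (tdist ps) e (C v) v q p))"

text \<open>In the end a single vertex, the root, represents the whole tree.\<close>

lemma wp_contract:
  assumes \<sigma>: "\<sigma> Base = n + 10" "\<sigma> Order = n" "\<sigma> Entries = n + 1" "\<sigma> Merges = n - 1"
    and g: "growth 0 ps" "verts 0 ps = {0..<n}"
    and e: "\<And>x. e x \<le> n" and b: "n \<le> b" and X: "n * n \<le> X"
    and I0: "contracted n ps e 0 M"
    and Q: "\<And>M. contracted n ps e (n - 1) M \<Longrightarrow> Q M"
  shows "wp b X contract \<sigma> Q M"
  unfolding contract_def
proof (rule wp_loop[where I = "contracted n ps e"])
  show "contracted n ps e 0 M" by (rule I0)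
next
  fix M assume "contracted n ps e (\<sigma> Merges) M" then show "Q M" using Q by (simp add: \<sigma>)
next
  fix k M assume k: "k < \<sigma> Merges" and I: "contracted n ps e k M"
  let ?d = "tdist ps" and ?B = "n + 10" and ?W = "verts 0 (drop (Suc k) ps)"
  have len: "length ps = n - 1" using card_verts[OF g(1)] g(2) by simp
  then have k: "k < length ps" using k by (simp add: \<sigma>)
  obtain c r where cr: "ps ! k = (c, r)" by fastforce
  have dk: "drop k ps = (c, r) # drop (Suc k) ps" using Cons_nth_drop_Suc[OF k] cr by simp
  have W: "verts 0 (drop k ps) = insert c ?W" using dk by simp
  have gk: "c \<notin> ?W" "r \<in> ?W" using growth_drop[OF g(1), of k] dk by simp_all
  have Wn: "w < n" if "w \<in> insert c ?W" for w
    using verts_drop_subset[of 0 k ps] that W g(2) by auto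
  have leaf: "?d c w = ?d r w + 1" if "w \<in> ?W" for w
  proof -
    have "?d c w = tdist (drop k ps) c w" "?d r w = tdist (drop k ps) r w"
      using tdist_drop[OF g(1), of _ k] W that gk by auto
    then show ?thesis using that gk unfolding dk by auto
  qed
  obtain C where C: "clusters n ?d (insert c ?W) C"
    and T: "\<And>v q p. v \<in> insert c ?W \<Longrightarrow> q \<le> n \<Longrightarrow> p \<le> n \<Longrightarrow> M (ad ?B 6 v q p) = opt ?d e (C v) v q p"
    using I unfolding contracted_def W by blast
  have P: "M (ad ?B 3 0 0 i) = fst (ps ! i) \<and> M (ad ?B 4 0 0 i) = snd (ps ! i)" if "i < length ps" for i
    using I that unfolding contracted_def by blast
  have dn: "?d x y \<le> n" for x y using tdist_le_length[of ps x y] len by simp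
  note merge = clusters_leaf[OF C gk, of e, OF tdist_sym tdist_refl leaf dn e]
  have sub: "C r \<union> C c \<subseteq> {0..<n}" using C gk unfolding clusters_def by blast
  have bound: "opt ?d e (C r \<union> C c) r q p \<le> X" for q p
  proof -
    have "opt ?d e (C r \<union> C c) r q p \<le> (\<Sum>x\<in>C r \<union> C c. e x)" by (rule opt_le_sum)
    also have "\<dots> \<le> (\<Sum>x\<in>{0..<n}. e x)" using sub by (intro sum_mono2) auto
    also have "\<dots> \<le> (\<Sum>x\<in>{0..<n}. n)" by (intro sum_mono e)
    finally show ?thesis using X by simp
  qed
  have "wp b X merge_tables (\<sigma>(VK := k, VC := c, VR := r)) (contracted n ps e (Suc k)) M"
  proof (rule wp_merge_tables[where n = n and r = r and c = c and A = "opt ?d e (C r) r" and A' = "opt ?d e (C c) c"])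
    fix M' assume new: "\<And>q p. q \<le> n \<Longrightarrow> p \<le> n \<Longrightarrow>
        M' (ad ?B 6 r q p) = merge n (opt ?d e (C r) r) (opt ?d e (C c) c) q p"
      and old: "\<And>a. (\<And>q p. q \<le> n \<Longrightarrow> p \<le> n \<Longrightarrow> a \<noteq> ad ?B 6 r q p) \<Longrightarrow> M' a = M a"
    let ?C = "C(r := C r \<union> C c)"
    have "M' (ad ?B 3 0 0 i) = fst (ps ! i) \<and> M' (ad ?B 4 0 0 i) = snd (ps ! i)" if "i < length ps" for i
    proof -
      have "M' (ad ?B 3 0 0 i) = M (ad ?B 3 0 0 i)" "M' (ad ?B 4 0 0 i) = M (ad ?B 4 0 0 i)"
        using that len Wn[of r] gk by (auto intro!: old)
      then show ?thesis using P[OF that] by simp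
    qed
    moreover have "M' (ad ?B 6 v q p) = opt ?d e (?C v) v q p" if "v \<in> ?W" "q \<le> n" "p \<le> n" for v q p
    proof (cases "v = r")
      case True
      then show ?thesis using new[of q p] that merge(2) by simp
    next
      case False
      have "M' (ad ?B 6 v q p) = M (ad ?B 6 v q p)"
        using that False Wn[of r] Wn[of v] gk by (intro old) auto
      then show ?thesis using T[of v q p] that False by simp
    qed
    ultimately show "contracted n ps e (Suc k) M'"
      unfolding contracted_def using merge(1) by blast
  next
    show "merge n (opt ?d e (C r) r) (opt ?d e (C c) c) q p \<le> X" for q p
      using bound[of q p] merge(2) by simp
  qed (use \<sigma> Wn gk b T in auto)
  then show "wp b X (Bind VC (Read (child (Var VK))) (Bind VR (Read (parent (Var VK))) merge_tables))
    (\<sigma>(VK := k)) (contracted n ps e (Suc k)) M"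
    using P[OF k] cr Wn[of c] Wn[of r] gk b by (simp add: wp_simps(4) \<sigma>)
qed

section \<open>Correctness and running time\<close>

lemma mx_min:
  assumes "0 < n"
  shows "mx (\<lambda>x. min p (g x)) n = min p (Max (g ` {0..<n}))"
proof (rule antisym)
  show "mx (\<lambda>x. min p (g x)) n \<le> min p (Max (g ` {0..<n}))"
    by (rule mx_least) (auto intro!: min.coboundedI2)
  have "Max (g ` {0..<n}) \<in> g ` {0..<n}" using assms by (intro Max_in) auto
  then obtain x where "x < n" "Max (g ` {0..<n}) = g x" by auto
  then show "min p (Max (g ` {0..<n})) \<le> mx (\<lambda>x. min p (g x)) n"
    using mx_upper[of x n "\<lambda>x. min p (g x)"] by simp
qed

text \<open>For \<open>q = 0\<close> and \<open>p = n\<close> the last condition of feasibility holds for every broadcast, as eccentricities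
are at most \<open>n\<close>; what remains is the definition of an independent broadcast.\<close>

lemma broadcast_independence_number_eq_opt:
  assumes g: "growth 0 ps" and V: "verts 0 ps = {0..<n}"
  shows "broadcast_independence_number {0..<n} (edges ps) =
    opt (tdist ps) (\<lambda>x. Max (tdist ps x ` {0..<n})) {0..<n} 0 0 n"
proof -
  let ?e = "\<lambda>x. Max (tdist ps x ` {0..<n})"
  have n: "0 < n" using root_in_verts[of 0 ps] V by auto
  have len: "length ps < n" using card_verts[OF g] V by simp
  have d: "gdist {0..<n} (edges ps) x y = tdist ps x y" if "x < n" "y < n" for x y
    using gdist_eq_tdist[OF g, of x y] that V by simp
  have ecc: "ecc {0..<n} (edges ps) x = ?e x" if "x < n" for x
    unfolding ecc_def using d that by (intro arg_cong[of _ _ Max] image_cong) auto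
  have en: "?e x \<le> n" for x
    using n len by (auto intro!: le_trans[OF tdist_le_length])
  have "independent_broadcast {0..<n} (edges ps) f \<longleftrightarrow> feasible (tdist ps) ?e {0..<n} 0 0 n f" for f
  proof -
    have "(\<forall>x\<in>{0..<n}. f x \<le> ecc {0..<n} (edges ps) x) \<longleftrightarrow> (\<forall>x\<in>{0..<n}. f x \<le> ?e x)"
      using ecc by simp
    moreover have "f x \<le> n + tdist ps 0 x" if "f x \<le> ?e x" for x
      using that en[of x] by simp
    ultimately show ?thesis
      unfolding independent_broadcast_def feasible_def using d by auto
  qed
  then show ?thesis unfolding broadcast_independence_number_def opt_def by simp
qed

lemma length_concat_pairs: "length (concat (map (\<lambda>(u, v). [u, v]) es)) = 2 * length es"
  by (induction es) auto

lemma nth_concat_pairs: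
  "j < length es \<Longrightarrow> concat (map (\<lambda>(u, v). [u, v]) es) ! (2 * j) = fst (es ! j) \<and>
     concat (map (\<lambda>(u, v). [u, v]) es) ! Suc (2 * j) = snd (es ! j)"
proof (induction es arbitrary: j)
  case (Cons e es)
  then show ?case by (cases j; cases e) auto
qed simp

text \<open>The phases are chained backwards, each with the weakest precondition of the remaining ones as its
postcondition.\<close>

lemma wp_main:
  assumes T: "is_tree {0..<n} E" and es: "edge_list_of E es"
    and M: "M = (\<lambda>a. if a < length (graph_input n es) then graph_input n es ! a else 0)"
  shows "wp (n + 10) ((n + 10)\<^sup>2) main (\<lambda>_. 0) (\<lambda>M. M 0 = broadcast_independence_number {0..<n} E) M"
    and "M a \<le> (n + 10)\<^sup>2" and "0 < n"
proof -
  let ?b = "n + 10" and ?X = "(n + 10)\<^sup>2"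
  have n: "0 < n" using T unfolding is_tree_def simple_graph_def by auto
  show "0 < n" by (rule n)
  have E: "E = edges es" using es unfolding edge_list_of_def edges_def by simp
  have conn: "connected_graph {0..<n} (edges es)" using T E unfolding is_tree_def by simp
  have esn: "u < n \<and> v < n" if "(u, v) \<in> set es" for u v
  proof -
    have "{u, v} \<in> E" using that unfolding E edges_def by force
    then show ?thesis using T unfolding is_tree_def simple_graph_def by auto
  qed
  obtain ps0 where ps0: "growth 0 ps0" "verts 0 ps0 = {0..<n}" "E = edges ps0"
    using tree_growth_exists[OF T, of 0] n by auto
  have m: "length es < n"
    using es card_edges_le[of ps0] card_verts[OF ps0(1)] ps0(2,3) unfolding edge_list_of_def by simp
  have X: "2 * n + 10 \<le> ?X" "n * n \<le> ?X" "n \<le> ?X" by (auto simp: power2_eq_square algebra_simps)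
  have M0: "M 0 = n" "M 1 = length es" using M by (simp_all add: graph_input_def)
  have Min: "M (2 + 2 * j) = fst (es ! j)" "M (3 + 2 * j) = snd (es ! j)" if "j < length es" for j
  proof -
    have "3 + 2 * j = Suc (Suc (Suc (2 * j)))" "2 + 2 * j = Suc (Suc (2 * j))" by simp_all
    then show "M (2 + 2 * j) = fst (es ! j)" "M (3 + 2 * j) = snd (es ! j)"
      using that nth_concat_pairs[OF that] unfolding M graph_input_def
      by (simp_all add: length_concat_pairs)
  qed
  have Mad: "M (ad ?b t i j k) = 0" if "1 \<le> t" for t i j k
  proof -
    have "length (graph_input n es) < 2 * n + 10"
      using m by (simp add: graph_input_def length_concat_pairs)
    then have "\<not> ad ?b t i j k < length (graph_input n es)"
      using input_neq_ad(2)[OF _ that, of "ad ?b t i j k" n i j k] by linarith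
    then show ?thesis using M by simp
  qed
  show "M a \<le> ?X" for a
  proof -
    have "x \<le> n" if "x \<in> set (graph_input n es)" for x
      using that m esn unfolding graph_input_def by (force intro: less_imp_le)
    then have "M a \<le> n" using M nth_mem by simp
    then show ?thesis using X(3) by (rule le_trans)
  qed
  let ?\<sigma> = "(\<lambda>_. 0)(Order := n, Edges := length es, Base := n + 10, Entries := n + 1, Merges := n - 1)"
  let ?M = "M(ad ?b 1 0 0 0 := 1, ad ?b 2 0 0 0 := n - 1)"
  have G: "grown n es [] ?M"
    unfolding grown_def using Mad Min n m by (auto simp: input_neq_ad)
  let ?out = "Write (Const 0) (Read (table (Const 0) (Const 0) (Var Order)))"
  let ?Q = "\<lambda>M. M 0 = broadcast_independence_number {0..<n} E"
  have "wp ?b ?X search ?\<sigma> (wp ?b ?X (init_tables ;; contract ;; ?out) ?\<sigma> ?Q) ?M"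
  proof (rule wp_search[OF G])
    fix M1 ps assume g1: "grown n es ps M1" and V: "verts 0 ps = {0..<n}"
    have g: "growth 0 ps" and len: "length ps = n - 1"
      using grownD[OF g1] V by simp_all
    have Eps: "E = edges ps"
      using tree_edges_eq_growth[of 0 ps E] T V g g1 E unfolding grown_def by simp
    let ?d = "tdist ps" and ?e = "\<lambda>x. Max (tdist ps x ` {0..<n})"
    have en: "?e x \<le> n" for x
      using n len by (auto intro!: le_trans[OF tdist_le_length])
    have bin: "broadcast_independence_number {0..<n} E = opt ?d ?e {0..<n} 0 0 n"
      unfolding Eps by (rule broadcast_independence_number_eq_opt[OF g V])
    have "wp ?b ?X init_tables ?\<sigma> (wp ?b ?X (contract ;; ?out) ?\<sigma> ?Q) M1"
    proof (rule wp_init_tables[where n = n and d = ?d])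
      show "M1 (ad ?b 5 0 v x) = ?d v x" if "v < n" "x < n" for v x
        using g1 that V unfolding grown_def by simp
    next
      fix M2
      assume new: "\<And>v p. v < n \<Longrightarrow> p \<le> n \<Longrightarrow> M2 (ad ?b 6 v 0 p) = mx (\<lambda>x. min p (?d v x)) n"
        and old: "\<And>a. (\<And>v p. v < n \<Longrightarrow> p \<le> n \<Longrightarrow> a \<noteq> ad ?b 6 v 0 p) \<Longrightarrow> M2 a = M1 a"
      have "M2 (ad ?b 3 0 0 i) = fst (ps ! i) \<and> M2 (ad ?b 4 0 0 i) = snd (ps ! i)" if "i < length ps" for i
      proof -
        have "M2 (ad ?b 3 0 0 i) = M1 (ad ?b 3 0 0 i)" "M2 (ad ?b 4 0 0 i) = M1 (ad ?b 4 0 0 i)"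
          using that len by (auto intro!: old)
        moreover have "M1 (ad ?b 3 0 0 i) = fst (ps ! i) \<and> M1 (ad ?b 4 0 0 i) = snd (ps ! i)"
          using g1 that len unfolding grown_def by simp
        ultimately show ?thesis by simp
      qed
      \<comment> \<open>At first every vertex is a cluster of its own.\<close>
      moreover have "clusters n ?d {0..<n} (\<lambda>v. {v})" unfolding clusters_def by auto
      moreover have "M2 (ad ?b 6 v q p) = opt ?d ?e {v} v q p" if "v < n" "q \<le> n" "p \<le> n" for v q p
      proof (cases "q = 0")
        case True
        then show ?thesis using new[of v p] that mx_min[OF n, of p "?d v"] by (simp add: opt_singleton)
      next
        case False
        have "M2 (ad ?b 6 v q p) = M1 (ad ?b 6 v q p)" using that False by (intro old) auto
        also have "\<dots> = 0" using g1 that unfolding grown_def by simp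
        finally show ?thesis using False by (simp add: opt_singleton)
      qed
      ultimately have C0: "contracted n ps ?e 0 M2"
        unfolding contracted_def using V by (intro conjI exI[of _ "\<lambda>v. {v}"]) auto
      have "wp ?b ?X contract ?\<sigma> (wp ?b ?X ?out ?\<sigma> ?Q) M2"
      proof (rule wp_contract[OF _ _ _ _ g V en _ _ C0])
        fix M3 assume "contracted n ps ?e (n - 1) M3"
        then obtain C where "clusters n ?d {0} C" "M3 (ad ?b 6 0 0 n) = opt ?d ?e (C 0) 0 0 n"
          unfolding contracted_def using len by auto
        then have M3: "M3 (ad ?b 6 0 0 n) = opt ?d ?e {0..<n} 0 0 n"
          unfolding clusters_def by simp
        have "opt ?d ?e {0..<n} 0 0 n \<le> (\<Sum>x\<in>{0..<n}. ?e x)" by (rule opt_le_sum)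
        also have "\<dots> \<le> (\<Sum>x\<in>{0..<n}. n)" by (intro sum_mono en)
        finally have "opt ?d ?e {0..<n} 0 0 n \<le> ?X" using X by simp
        then show "wp ?b ?X ?out ?\<sigma> ?Q M3" using M3 bin by (simp add: wp_simps)
      qed (use X in auto)
      then show "wp ?b ?X (contract ;; ?out) ?\<sigma> ?Q M2" by (simp only: wp_simps(2))
    qed (use X in auto)
    then show "wp ?b ?X (init_tables ;; contract ;; ?out) ?\<sigma> ?Q M1" by (simp only: wp_simps(2))
  qed (use conn esn m n X in auto)
  then have S: "wp ?b ?X (search ;; init_tables ;; contract ;; ?out) ?\<sigma> ?Q ?M"
    by (simp only: wp_simps(2))
  have "1 \<le> ?X" "n - 1 \<le> ?X" using X by auto
  then have "wp ?b ?X (Write (visited (Const 0)) (Const 1) ;; Write counter (Var Merges) ;;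
      search ;; init_tables ;; contract ;; ?out) ?\<sigma> ?Q M"
    using S by (simp add: wp_simps(1) wp_simps(2)[of _ _ "Write _ _"])
  then show "wp ?b ?X main (\<lambda>_. 0) ?Q M"
    unfolding main_def using M0 m by (simp add: wp_simps(4))
qed

text \<open>The word limit may be any power of \<open>n + 1\<close>, and \<open>n + 10 \<le> (n + 1) ^ 4\<close> for \<open>n \<ge> 1\<close>.\<close>

lemma program_bound: "(n + 10)\<^sup>2 ^ s < (n + 1) ^ (8 * s + 1)" if "0 < n" for n s :: nat
proof -
  have "n + 10 \<le> (n + 1) * (2 * 2 * 2)" using that by simp
  also have "\<dots> \<le> (n + 1) * ((n + 1) * (n + 1) * (n + 1))"
    using that by (intro mult_left_mono mult_mono) auto
  also have "\<dots> = (n + 1) ^ 4" by (simp add: eval_nat_numeral)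
  finally have "(n + 10) ^ (2 * s) \<le> ((n + 1) ^ 4) ^ (2 * s)" by (rule power_mono) simp
  also have "\<dots> = (n + 1) ^ (8 * s)" by (simp flip: power_mult)
  also have "\<dots> < (n + 1) ^ (8 * s + 1)" using that by simp
  finally show ?thesis by (simp flip: power_mult)
qed

text \<open>The deepest nest consists of the \<open>n - 1\<close> merging steps, the two indices of a table and the two maxima
in the recurrence.\<close>

lemma depth_main: "cmd_depth main \<le> 5"
  by (simp add: main_def search_def init_tables_def contract_def merge_tables_def attach_def
      cell_def Max2_def Min2_def)

theorem theorem1p2:
  "\<exists>(P :: ram_prog) (d :: nat) (T :: nat \<Rightarrow> nat).
     (\<lambda>n. real (T n)) \<in> O(\<lambda>n. real n ^ 9) \<and>
     (\<forall>(n :: nat) (E :: nat set set) (es :: (nat \<times> nat) list).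
        is_tree {0..<n} E \<and> edge_list_of E es \<longrightarrow>
        (\<exists>t \<le> T n. ram_computes ((n + 1) ^ d) P (graph_input n es) t
                     (broadcast_independence_number {0..<n} E)))"
proof -
  \<comment> \<open>Register \<open>0\<close> is below all registers in use, so it still holds \<open>0\<close> and can serve as the address of the result.\<close>
  let ?P = "SEQ (comp_cmd main (\<lambda>_. 0) 1) (LOAD 0 0)"
  let ?s = "cmd_size main"
  let ?K = "cmd_time 1 main"
  let ?T = "\<lambda>n. ?K * (n + 10) ^ 5 + 1"
  have time: "(\<lambda>n. real (?T n)) \<in> O(\<lambda>n. real n ^ 9)"
  proof (rule bigoI)
    show "\<forall>\<^sub>F n in sequentially. norm (real (?T n)) \<le> real (?K * 11 ^ 5 + 1) * norm (real n ^ 9)"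
    proof (rule eventually_sequentiallyI[of 1])
      fix n :: nat assume n: "1 \<le> n"
      have "(n + 10) ^ 5 \<le> (11 * n) ^ 5" using n by (intro power_mono) auto
      also have "\<dots> \<le> 11 ^ 5 * n ^ 9"
        using n by (simp add: power_mult_distrib power_increasing)
      finally have "?K * (n + 10) ^ 5 \<le> ?K * (11 ^ 5 * n ^ 9)" by (rule mult_left_mono) simp
      moreover have "1 \<le> n ^ 9" using n by simp
      ultimately have "?T n \<le> (?K * 11 ^ 5 + 1) * n ^ 9"
        unfolding distrib_right mult.assoc mult_1 by (rule add_mono)
      then have "real (?T n) \<le> real ((?K * 11 ^ 5 + 1) * n ^ 9)" by (rule of_nat_mono)
      then show "norm (real (?T n)) \<le> real (?K * 11 ^ 5 + 1) * norm (real n ^ 9)"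
        by (simp only: of_nat_mult of_nat_power real_norm_def abs_of_nat abs_of_nonneg of_nat_0_le_iff zero_le_power)
    qed
  qed
  have computes: "\<exists>t\<le>?T n. ram_computes ((n + 1) ^ (8 * ?s + 1)) ?P (graph_input n es) t
      (broadcast_independence_number {0..<n} E)"
    if T: "is_tree {0..<n} E" and es: "edge_list_of E es" for n E es
  proof -
    let ?b = "n + 10" and ?X = "(n + 10)\<^sup>2" and ?L = "(n + 1) ^ (8 * ?s + 1)"
    define M where "M = (\<lambda>a. if a < length (graph_input n es) then graph_input n es ! a else 0)"
    note main = wp_main[OF T es M_def]
    have L: "?X ^ ?s < ?L" by (rule program_bound[OF main(3)])
    have "?X ^ 1 \<le> ?X ^ ?s"
      by (rule power_increasing) (auto simp: main_def)
    then have XL: "?X < ?L" using L by simp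
    have X2: "?b \<le> ?X" by (simp add: power2_eq_square)
    have X1: "2 \<le> ?X" by (rule le_trans[OF _ X2]) simp
    have "reach ?L (comp_cmd main (\<lambda>_. 0) 1) (\<lambda>_. 0, M) (cmd_time ?b main)
      (\<lambda>R' M'. M' = run main (\<lambda>_. 0) M \<and> (\<forall>a. M' a \<le> ?X) \<and> (\<forall>i<1. R' i = (0::nat)))"
      using main(1) comp_cmd_correct[OF X1 X2 L, of "\<lambda>_. 0" 1 "\<lambda>_. 0" "\<lambda>_. 0" M] main(2)
      by (simp add: wp_def)
    then have "reach ?L ?P (\<lambda>_. 0, M) (cmd_time ?b main + 1)
      (\<lambda>R' M'. R' 0 = broadcast_independence_number {0..<n} E)"
      by (intro reach_seq, elim reach_mono[OF _ order_refl])
        (use main(1) XL in \<open>auto simp: wp_def intro!: reach_load[simplified] intro: le_less_trans\<close>)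
    then obtain t R' M' where t: "t \<le> cmd_time ?b main + 1" "ram_exec ?L ?P (\<lambda>_. 0, M) t (R', M')"
      "R' 0 = broadcast_independence_number {0..<n} E"
      unfolding reach_def by blast
    have "cmd_time ?b main \<le> ?K * ?b ^ cmd_depth main" by (rule cmd_time_poly) simp
    also have "\<dots> \<le> ?K * ?b ^ 5"
      using depth_main by (intro mult_left_mono power_increasing) auto
    finally have "t \<le> ?T n" using t(1) by simp
    then show ?thesis using t(2,3) unfolding ram_computes_def M_def by blast
  qed
  show ?thesis
    by (rule exI[of _ ?P], rule exI[of _ "8 * ?s + 1"], rule exI[of _ ?T]) (use time computes in blast)
qed

end
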